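(* Let $\pi\in\mathcal P(\mathcal X)$, let $\mathcal B=\{P_1,\dots,P_n\}\subset\mathcal L(\mathcal X)$ be a family of $\pi$-stationary transition matrices, let $\mathbf S=(S_1,\dots,S_m)$ be a partition of $[d]$, and consider the two-person mixed strategy game with parameters $(\mathbf S,\mathcal B)$ described in the context. 1. The mixed strategy Nash equilibrium always exists. That is, the value of the game is well-defined and given by $$\overline V(\mathbf S,\mathcal B)=\underline V(\mathbf S,\mathcal B)=\max_{\mathbf w\in\mathcal S_n}\sum_{i=1}^nw_iD_{\mathrm{KL}}^\pi\big(P_i\|\otimes_{j=1}^m\overline P(\mathbf w)^{(S_j)}\big).$$ 2. The mixed strategy Nash equilibrium is attained at $(Q^*,\mu^* )$, where $\mu^*$ is represented by an optimal weight vector $\mathbf w^*\in\mathcal S_n$ (a maximizer of the right-hand side in item 1; $\mu^*$ puts mass $w_i^*$ on $P_i$), and $Q^*$ is the information projection of $\overline P(\mathbf w^* )$ onto $\mathcal F(\mathbf S)$, i.e. $Q^*=\otimes_{j=1}^m\overline P(\mathbf w^* )^{(S_j)}$.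
   Context: $[d]=\{1,\dots,d\}$; $\mathcal X=\mathcal X^{(1)}\times\cdots\times\mathcal X^{(d)}$ is a finite product state space; for $S\subseteq[d]$, $\mathcal X^{(S)}=\times_{i\in S}\mathcal X^{(i)}$, $-S=[d]\setminus S$. $\mathcal L(\mathcal Y)$ is the set of transition matrices on $\mathcal Y$. $\mathcal P(\mathcal X)$ is the set of probability mass functions on $\mathcal X$ with full support. $P$ is $\pi$-stationary if $\pi P=\pi$. $\mathcal S_n=\{\mathbf w\in\mathbb R_+^n:\sum_iw_i=1\}$, $\overline P(\mathbf w)=\sum_{i=1}^nw_iP_i$. For $P\in\mathcal L(\mathcal X)$, the keep-$S$-in matrix with respect to $\pi$ is $P^{(S)}\in\mathcal L(\mathcal X^{(S)})$, $$P^{(S)}(x^{(S)},y^{(S)})=\frac{\sum_{x^{(-S)},y^{(-S)}}\pi(x)P(x,y)}{\sum_{x^{(-S)}}\pi(x)},\qquad P^{(\emptyset)}=1.$$ $(\otimes_{j=1}^mM_j)(x,y)=\prod_jM_j(x^{(S_j)},y^{(S_j)})$. $\mathcal F=\mathcal F(\mathbf S)=\{Q\in\mathcal L(\mathcal X):Q=Q^{(S_1)}\otimes\cdots\otimes Q^{(S_m)}\}$. $D_{\mathrm{KL}}^{\pi}(M\|L)=\sum_x\pi(x)\sum_yM(x,y)\ln\frac{M(x,y)}{L(x,y)}$, with $0\ln\frac0a:=0$ for $a\in[0,1]$, $b\ln\frac b0:=+\infty$ for $b>0$, $0\cdot\infty:=0$. The game: zero-sum, between Nature and a probabilist. Nature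 chooses a probability measure $\mu$ on $\mathcal B$ (the set of all of them is denoted $\mathcal P(\mathcal B)$; they correspond to weight vectors $\mathbf w\in\mathcal S_n$); the probabilist chooses a single $Q\in\mathcal F$. The payoff from the probabilist to Nature is $\int_{\mathcal B}D_{\mathrm{KL}}^\pi(P\|Q)\,\mu(\mathrm dP)$, which Nature maximizes and the probabilist minimizes. A Nash equilibrium is a pair $(Q^*,\mu^* )$ in which each strategy is a best response to the other (a saddle point of the payoff). The minimax and maximin values are $$\overline V(\mathbf S,\mathcal B)=\min_{Q\in\mathcal F}\max_{\mu\in\mathcal P(\mathcal B)}\int_{\mathcal B}D_{\mathrm{KL}}^\pi(P\|Q)\,\mu(\mathrm dP),\qquad\underline V(\mathbf S,\mathcal B)=\max_{\mu\in\mathcal P(\mathcal B)}\min_{Q\in\mathcal F}\int_{\mathcal B}D_{\mathrm{KL}}^\pi(P\|Q)\,\mu(\mathrm dP).$$ *)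

theory Defs
  imports "HOL-Probability.Probability"
begin

text \<open>
  A point of the product space is a function on coordinates that is \<open>undefined\<close> outside its index
  set, so \<open>PiE S E\<close> is the space of \<open>S\<close>-coordinates and \<open>restrict x S\<close> is the projection \<open>x\<^sup>S\<close>.
  A matrix on \<open>Y\<close> is a function that is 0 off \<open>Y \<times> Y\<close>, so that equality of matrices is
  equality of functions.
\<close>

type_synonym 'a state = "nat \<Rightarrow> 'a"

type_synonym 'y matrix = "'y \<Rightarrow> 'y \<Rightarrow> real"

definition transition_matrices :: "'y set \<Rightarrow> 'y matrix set" where
  "transition_matrices Y =
     {P. (\<forall>x y. 0 \<le> P x y) \<and> (\<forall>x y. x \<notin> Y \<or> y \<notin> Y \<longrightarrow> P x y = 0) \<and>
         (\<forall>x\<in>Y. (\<Sum>y\<in>Y. P x y) = 1)}"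

definition stationary :: "'y set \<Rightarrow> 'y pmf \<Rightarrow> 'y matrix \<Rightarrow> bool" where
  "stationary Y \<pi> P \<longleftrightarrow> (\<forall>y\<in>Y. (\<Sum>x\<in>Y. pmf \<pi> x * P x y) = pmf \<pi> y)"

text \<open>
  Summing over the coordinates outside \<open>S\<close> is summing over the states with the given
  \<open>S\<close>-coordinates. If \<open>x\<close> or \<open>y\<close> is not the projection of a state, the numerator is an
  empty sum, so the matrix is 0 off its carrier.
\<close>

definition keep_in ::
    "'a state set \<Rightarrow> 'a state pmf \<Rightarrow> nat set \<Rightarrow> 'a state matrix \<Rightarrow> 'a state matrix" where
  "keep_in X \<pi> S P x y =
     (\<Sum>u\<in>{u\<in>X. restrict u S = x}. \<Sum>v\<in>{v\<in>X. restrict v S = y}. pmf \<pi> u * P u v) /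
     (\<Sum>u\<in>{u\<in>X. restrict u S = x}. pmf \<pi> u)"

definition tensor ::
    "'a state set \<Rightarrow> (nat \<Rightarrow> nat set) \<Rightarrow> nat \<Rightarrow> (nat \<Rightarrow> 'a state matrix) \<Rightarrow> 'a state matrix" where
  "tensor X S m M x y =
     (if x \<in> X \<and> y \<in> X
      then \<Prod>j\<in>{1..m}. M j (restrict x (S j)) (restrict y (S j)) else 0)"

definition keep_in_tensor ::
    "'a state set \<Rightarrow> 'a state pmf \<Rightarrow> (nat \<Rightarrow> nat set) \<Rightarrow> nat \<Rightarrow> 'a state matrix \<Rightarrow> 'a state matrix" where
  "keep_in_tensor X \<pi> S m P = tensor X S m (\<lambda>j. keep_in X \<pi> (S j) P)"

definition factorizable ::
    "'a state set \<Rightarrow> 'a state pmf \<Rightarrow> (nat \<Rightarrow> nat set) \<Rightarrow> nat \<Rightarrow> 'a state matrix set" where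
  "factorizable X \<pi> S m = {Q \<in> transition_matrices X. Q = keep_in_tensor X \<pi> S m Q}"

definition kl_term :: "real \<Rightarrow> real \<Rightarrow> ereal" where
  "kl_term a b = (if a = 0 then 0 else if b = 0 then \<infinity> else ereal (a * ln (a / b)))"

definition KL :: "'y set \<Rightarrow> 'y pmf \<Rightarrow> 'y matrix \<Rightarrow> 'y matrix \<Rightarrow> ereal" where
  "KL Y \<pi> M L = (\<Sum>x\<in>Y. ereal (pmf \<pi> x) * (\<Sum>y\<in>Y. kl_term (M x y) (L x y)))"

lemma KL_nonneg:
  assumes "M \<in> transition_matrices Y" "L \<in> transition_matrices Y"
  shows "0 \<le> KL Y \<pi> M L"
proof -
  have term_ge: "ereal (a - b) \<le> kl_term a b" if "0 \<le> a" "0 \<le> b" for a b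
  proof (cases "a = 0 \<or> b = 0")
    case True
    then show ?thesis using that by (auto simp: kl_term_def)
  next
    case False
    then have pos: "0 < a" "0 < b" using that by auto
    have "ln (b / a) \<le> b / a - 1" using pos by (intro ln_le_minus_one) simp
    then have "a * ln (b / a) \<le> a * (b / a - 1)" using pos by (intro mult_left_mono) auto
    then have "a - b \<le> a * ln (a / b)" using pos by (simp add: ln_div algebra_simps)
    then show ?thesis using False by (simp add: kl_term_def)
  qed
  have "0 \<le> (\<Sum>y\<in>Y. kl_term (M x y) (L x y))" if "x \<in> Y" for x
  proof -
    have "(\<Sum>y\<in>Y. M x y - L x y) = 0"
      using assms that by (simp add: transition_matrices_def sum_subtractf)
    then have "0 = (\<Sum>y\<in>Y. ereal (M x y - L x y))" by (simp add: zero_ereal_def)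
    also have "\<dots> \<le> (\<Sum>y\<in>Y. kl_term (M x y) (L x y))"
      using assms by (intro sum_mono term_ge) (auto simp: transition_matrices_def)
    finally show ?thesis .
  qed
  then show ?thesis unfolding KL_def by (intro sum_nonneg) simp
qed

definition weight_simplex :: "nat \<Rightarrow> (nat \<Rightarrow> real) set" where
  "weight_simplex n = {w \<in> PiE {1..n} (\<lambda>_. {0..}). (\<Sum>i\<in>{1..n}. w i) = 1}"

definition mixture :: "nat \<Rightarrow> (nat \<Rightarrow> 'y matrix) \<Rightarrow> (nat \<Rightarrow> real) \<Rightarrow> 'y matrix" where
  "mixture n P w = (\<lambda>x y. \<Sum>i\<in>{1..n}. w i * P i x y)"

definition prob_measures :: "'b set \<Rightarrow> 'b measure set" where
  "prob_measures B = {\<mu>. prob_space \<mu> \<and> space \<mu> = B \<and> sets \<mu> = Pow B}"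

text \<open>
  The measure putting mass \<open>w i\<close> on \<open>P i\<close>, as a push-forward: if the family \<open>P\<close> has
  repetitions, their masses add up.
\<close>

definition weight_measure :: "nat \<Rightarrow> (nat \<Rightarrow> 'b) \<Rightarrow> (nat \<Rightarrow> real) \<Rightarrow> 'b measure" where
  "weight_measure n P w =
     distr (point_measure {1..n} (\<lambda>i. ennreal (w i))) (count_space (P ` {1..n})) P"

text \<open>
  Divergences may be infinite, hence the nonnegative Lebesgue integral. By \<open>KL_nonneg\<close> the
  conversion \<open>e2ennreal\<close> truncates nothing on transition matrices.
\<close>

definition payoff :: "'y set \<Rightarrow> 'y pmf \<Rightarrow> 'y matrix measure \<Rightarrow> 'y matrix \<Rightarrow> ereal" where
  "payoff Y \<pi> \<mu> Q = enn2ereal (\<integral>\<^sup>+ P. e2ennreal (KL Y \<pi> P Q) \<partial>\<mu>)"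

definition nash_equilibrium ::
    "'a state set \<Rightarrow> 'a state pmf \<Rightarrow> (nat \<Rightarrow> nat set) \<Rightarrow> nat \<Rightarrow> 'a state matrix set \<Rightarrow>
     'a state matrix \<Rightarrow> 'a state matrix measure \<Rightarrow> bool" where
  "nash_equilibrium X \<pi> S m B Q \<mu> \<longleftrightarrow>
     Q \<in> factorizable X \<pi> S m \<and> \<mu> \<in> prob_measures B \<and>
     (\<forall>\<mu>'\<in>prob_measures B. payoff X \<pi> \<mu>' Q \<le> payoff X \<pi> \<mu> Q) \<and>
     (\<forall>Q'\<in>factorizable X \<pi> S m. payoff X \<pi> \<mu> Q \<le> payoff X \<pi> \<mu> Q')"

definition worst_payoff ::
    "'a state set \<Rightarrow> 'a state pmf \<Rightarrow> 'a state matrix set \<Rightarrow> 'a state matrix \<Rightarrow> ereal" where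
  "worst_payoff X \<pi> B Q = (SUP \<mu>\<in>prob_measures B. payoff X \<pi> \<mu> Q)"

definition best_payoff ::
    "'a state set \<Rightarrow> 'a state pmf \<Rightarrow> (nat \<Rightarrow> nat set) \<Rightarrow> nat \<Rightarrow> 'a state matrix measure \<Rightarrow> ereal" where
  "best_payoff X \<pi> S m \<mu> = (INF Q\<in>factorizable X \<pi> S m. payoff X \<pi> \<mu> Q)"

text \<open>
  The two values are infima and suprema in \<open>ereal\<close>; that they are attained, as the notation min and
  max presupposes, is expressed separately by
  \<open>upper_value_attained\<close> and \<open>lower_value_attained\<close>.
\<close>

definition upper_value ::
    "'a state set \<Rightarrow> 'a state pmf \<Rightarrow> (nat \<Rightarrow> nat set) \<Rightarrow> nat \<Rightarrow> 'a state matrix set \<Rightarrow> ereal" where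
  "upper_value X \<pi> S m B = (INF Q\<in>factorizable X \<pi> S m. worst_payoff X \<pi> B Q)"

definition lower_value ::
    "'a state set \<Rightarrow> 'a state pmf \<Rightarrow> (nat \<Rightarrow> nat set) \<Rightarrow> nat \<Rightarrow> 'a state matrix set \<Rightarrow> ereal" where
  "lower_value X \<pi> S m B = (SUP \<mu>\<in>prob_measures B. best_payoff X \<pi> S m \<mu>)"

definition upper_value_attained ::
    "'a state set \<Rightarrow> 'a state pmf \<Rightarrow> (nat \<Rightarrow> nat set) \<Rightarrow> nat \<Rightarrow> 'a state matrix set \<Rightarrow> bool" where
  "upper_value_attained X \<pi> S m B \<longleftrightarrow>
     (\<forall>Q\<in>factorizable X \<pi> S m. \<exists>\<mu>. is_arg_max (\<lambda>\<mu>. payoff X \<pi> \<mu> Q) (\<lambda>\<mu>. \<mu> \<in> prob_measures B) \<mu>) \<and>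
     (\<exists>Q. is_arg_min (worst_payoff X \<pi> B) (\<lambda>Q. Q \<in> factorizable X \<pi> S m) Q)"

definition lower_value_attained ::
    "'a state set \<Rightarrow> 'a state pmf \<Rightarrow> (nat \<Rightarrow> nat set) \<Rightarrow> nat \<Rightarrow> 'a state matrix set \<Rightarrow> bool" where
  "lower_value_attained X \<pi> S m B \<longleftrightarrow>
     (\<forall>\<mu>\<in>prob_measures B. \<exists>Q. is_arg_min (payoff X \<pi> \<mu>) (\<lambda>Q. Q \<in> factorizable X \<pi> S m) Q) \<and>
     (\<exists>\<mu>. is_arg_max (best_payoff X \<pi> S m) (\<lambda>\<mu>. \<mu> \<in> prob_measures B) \<mu>)"

definition weight_objective ::
    "'a state set \<Rightarrow> 'a state pmf \<Rightarrow> (nat \<Rightarrow> nat set) \<Rightarrow> nat \<Rightarrow> nat \<Rightarrow> (nat \<Rightarrow> 'a state matrix) \<Rightarrow>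
     (nat \<Rightarrow> real) \<Rightarrow> ereal" where
  "weight_objective X \<pi> S m n P w =
     (\<Sum>i\<in>{1..n}. ereal (w i) * KL X \<pi> (P i) (keep_in_tensor X \<pi> S m (mixture n P w)))"

definition optimal_weight ::
    "'a state set \<Rightarrow> 'a state pmf \<Rightarrow> (nat \<Rightarrow> nat set) \<Rightarrow> nat \<Rightarrow> nat \<Rightarrow> (nat \<Rightarrow> 'a state matrix) \<Rightarrow>
     (nat \<Rightarrow> real) \<Rightarrow> bool" where
  "optimal_weight X \<pi> S m n P w \<longleftrightarrow>
     is_arg_max (weight_objective X \<pi> S m n P) (\<lambda>w. w \<in> weight_simplex n) w"

definition information_projection ::
    "'a state set \<Rightarrow> 'a state pmf \<Rightarrow> (nat \<Rightarrow> nat set) \<Rightarrow> nat \<Rightarrow> 'a state matrix \<Rightarrow> 'a state matrix \<Rightarrow> bool" where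
  "information_projection X \<pi> S m M Q \<longleftrightarrow>
     is_arg_min (KL X \<pi> M) (\<lambda>Q. Q \<in> factorizable X \<pi> S m) Q"

end

theory Submission
  imports Defs
begin

text \<open>
  Write \<open>T M\<close> for the product of the keep-in matrices of \<open>M\<close>, and identify Nature's strategies with
  weight vectors \<open>w\<close> (\<open>prob_measures_eq_weight_measures\<close>); the payoff becomes the linear function
  \<open>w \<mapsto> \<Sum>i. w i * KL (P i) Q\<close>, called the risk below.

  The keep-in matrices of \<open>T M\<close> are those of \<open>M\<close>, because all other factors sum to one
  (\<open>flow_keep_in_tensor\<close>). The logarithm of the ratio of two product matrices is a sum of functions
  of single blocks, so it has the same expectation under \<open>M\<close> and under \<open>T M\<close>. This gives, for
  factorizable \<open>Q\<close> and \<open>M\<close> the \<open>w\<close>-mixture of the family, the compensation identity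
  (\<open>mixed_risk_compensation\<close>): the risk of \<open>Q\<close> is the risk of \<open>T M\<close> plus \<open>KL (T M) Q\<close>. Therefore
  \<open>T M\<close> is the best response to \<open>w\<close>, the weight objective is the payoff that \<open>w\<close> guarantees to
  Nature, and for a one-member family \<open>T M\<close> is the unique information projection of \<open>M\<close>.

  It remains to see that a maximizer \<open>w\<close> of the objective is part of a saddle point, that is, that no
  \<open>u\<close> does better than \<open>w\<close> against the response to \<open>w\<close> (\<open>risk_response_optimal\<close>). Perturbing \<open>w\<close>
  towards \<open>u\<close>, the two facts that \<open>w\<close> is optimal and that the perturbed response is not better
  against \<open>w\<close> than the response to \<open>w\<close> bound the risk of the perturbed response under \<open>u\<close> by the
  objective at \<open>w\<close>. The bound survives the limit since the divergence, with values in the extended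
  reals, is continuous in its second argument. The same continuity and compactness of the simplex
  give a maximizer (\<open>ex_optimal_weight\<close>). Equality of the values and all attainment claims follow
  from the saddle point.
\<close>

section \<open>Divergence between transition matrices\<close>

text \<open>
  Absolute continuity of each row of \<open>M\<close> with respect to the same row of \<open>L\<close>. When \<open>\<pi>\<close> has full
  support on a finite space it is exactly finiteness of the divergence, so it separates the part of
  the argument that is real arithmetic from the part where both sides are infinite.
\<close>
definition dominated :: "'y set \<Rightarrow> 'y matrix \<Rightarrow> 'y matrix \<Rightarrow> bool" where
  "dominated Y M L \<longleftrightarrow> (\<forall>x\<in>Y. \<forall>y\<in>Y. L x y = 0 \<longrightarrow> M x y = 0)"

lemma KL_dominated:
  assumes "dominated Y M L"
  shows "KL Y \<pi> M L = ereal (\<Sum>x\<in>Y. \<Sum>y\<in>Y. pmf \<pi> x * M x y * ln (M x y / L x y))"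
proof -
  have "kl_term (M x y) (L x y) = ereal (M x y * ln (M x y / L x y))" if "x \<in> Y" "y \<in> Y" for x y
    using assms that by (auto simp: dominated_def kl_term_def)
  then show ?thesis
    by (simp add: KL_def sum_ereal sum_distrib_left mult.assoc)
qed

lemma KL_not_dominated:
  assumes "finite Y" "Y \<subseteq> set_pmf \<pi>" "\<not> dominated Y M L"
  shows "KL Y \<pi> M L = \<infinity>"
proof -
  obtain x y where xy: "x \<in> Y" "y \<in> Y" "L x y = 0" "M x y \<noteq> 0"
    using assms(3) by (auto simp: dominated_def)
  have "(\<Sum>y\<in>Y. kl_term (M x y) (L x y)) = \<infinity>"
    using xy assms(1) by (auto simp: sum_Pinfty kl_term_def intro!: bexI[of _ y])
  moreover have "0 < pmf \<pi> x"
    using xy(1) assms(2) by (auto simp: pmf_positive_iff)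
  ultimately have "ereal (pmf \<pi> x) * (\<Sum>y\<in>Y. kl_term (M x y) (L x y)) = \<infinity>"
    by simp
  then show ?thesis
    unfolding KL_def using xy(1) assms(1) by (auto simp: sum_Pinfty)
qed

lemma KL_finite_iff:
  assumes "finite Y" "Y \<subseteq> set_pmf \<pi>"
  shows "KL Y \<pi> M L \<noteq> \<infinity> \<longleftrightarrow> dominated Y M L"
  using KL_not_dominated[OF assms] by (auto simp: KL_dominated)

text \<open>
  The equality case of Gibbs' inequality. As rows sum to one, the divergence is a \<open>\<pi>\<close>-weighted sum of gaps
  \<open>a ln (a / b) - (a - b)\<close>, each of which is nonnegative and vanishes only for \<open>a = b\<close>; since
  \<open>\<pi>\<close> charges every state, all gaps must vanish.
\<close>
lemma KL_eq_0_imp_eq: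
  assumes fin: "finite Y" and supp: "Y \<subseteq> set_pmf \<pi>"
    and M: "M \<in> transition_matrices Y" and L: "L \<in> transition_matrices Y"
    and KL: "KL Y \<pi> M L \<le> 0"
  shows "M = L"
proof -
  have dom: "dominated Y M L"
    using KL KL_finite_iff[OF fin supp] by force
  define gap where "gap x y = M x y * ln (M x y / L x y) - (M x y - L x y)" for x y
  have nonneg: "0 \<le> M x y" "0 \<le> L x y" for x y
    using M L by (auto simp: transition_matrices_def)
  have gap: "0 \<le> gap x y \<and> (gap x y = 0 \<longrightarrow> M x y = L x y)" if "x \<in> Y" "y \<in> Y" for x y
  proof (cases "M x y = 0")
    case True
    then show ?thesis using nonneg[where x=x and y=y] by (simp add: gap_def)
  next
    case False
    then have pos: "0 < M x y" "0 < L x y"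
      using dom that nonneg[where x=x and y=y] by (auto simp: dominated_def less_le)
    have eq: "gap x y = M x y * (L x y / M x y - 1 - ln (L x y / M x y))"
      using pos by (simp add: gap_def ln_div field_simps)
    have "ln (L x y / M x y) \<le> L x y / M x y - 1"
      using pos by (intro ln_le_minus_one) simp
    moreover have "L x y / M x y = 1" if "ln (L x y / M x y) = L x y / M x y - 1"
      using pos that by (intro ln_eq_minus_one) simp_all
    ultimately show ?thesis
      using pos by (auto simp: eq)
  qed
  have "(\<Sum>y\<in>Y. M x y - L x y) = 0" if "x \<in> Y" for x
    using M L that by (simp add: transition_matrices_def sum_subtractf)
  then have "(\<Sum>x\<in>Y. pmf \<pi> x * (\<Sum>y\<in>Y. gap x y)) =
      (\<Sum>x\<in>Y. \<Sum>y\<in>Y. pmf \<pi> x * M x y * ln (M x y / L x y))"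
    by (intro sum.cong) (simp_all add: gap_def sum_subtractf sum_distrib_left mult.assoc)
  then have "(\<Sum>x\<in>Y. pmf \<pi> x * (\<Sum>y\<in>Y. gap x y)) \<le> 0"
    using KL by (simp add: KL_dominated[OF dom])
  moreover have terms: "0 \<le> pmf \<pi> x * (\<Sum>y\<in>Y. gap x y)" if "x \<in> Y" for x
    using gap that by (intro mult_nonneg_nonneg sum_nonneg) auto
  ultimately have "(\<Sum>x\<in>Y. pmf \<pi> x * (\<Sum>y\<in>Y. gap x y)) = 0"
    by (simp add: sum_nonneg order_antisym)
  then have "\<forall>x\<in>Y. pmf \<pi> x * (\<Sum>y\<in>Y. gap x y) = 0"
    using terms fin by (subst (asm) sum_nonneg_eq_0_iff) auto
  then have "\<forall>x\<in>Y. (\<Sum>y\<in>Y. gap x y) = 0"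
    using supp by (metis mult_eq_0_iff pmf_eq_0_set_pmf subsetD)
  then have "gap x y = 0" if "x \<in> Y" "y \<in> Y" for x y
    using gap fin that sum_nonneg_eq_0_iff[of Y "gap x"] by auto
  then have "M x y = L x y" if "x \<in> Y" "y \<in> Y" for x y
    using gap[OF that] that by simp
  moreover have "M x y = L x y" if "x \<notin> Y \<or> y \<notin> Y" for x y
    using M L that unfolding transition_matrices_def by simp
  ultimately show ?thesis
    by (intro ext) blast
qed

text \<open>
  As a function of its second argument the integrand is continuous into the extended reals, the
  value \<open>\<infinity>\<close> at \<open>b = 0\<close> being the limit from the right. This is what lets the game be perturbed
  towards weight vectors at which some divergences may, a priori, be infinite.
\<close>
lemma tendsto_kl_term:
  assumes lim: "(f \<longlongrightarrow> b) F" and nonneg: "0 \<le> a" "\<And>k. 0 \<le> f k" "0 \<le> b"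
  shows "((\<lambda>k. kl_term a (f k)) \<longlongrightarrow> kl_term a b) F"
proof -
  consider "a = 0" | "0 < a" "0 < b" | "0 < a" "b = 0"
    using nonneg by fastforce
  then show ?thesis
  proof cases
    case 1
    then show ?thesis by (simp add: kl_term_def)
  next
    case 2
    then have "((\<lambda>k. ereal (a * ln (a / f k))) \<longlongrightarrow> ereal (a * ln (a / b))) F"
      using lim by (intro tendsto_intros) auto
    moreover have "\<forall>\<^sub>F k in F. 0 < f k"
      using lim 2 by (simp add: order_tendstoD)
    then have "\<forall>\<^sub>F k in F. ereal (a * ln (a / f k)) = kl_term a (f k)"
      by eventually_elim (use 2 in \<open>simp add: kl_term_def\<close>)
    ultimately have "((\<lambda>k. kl_term a (f k)) \<longlongrightarrow> ereal (a * ln (a / b))) F"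
      by (rule Lim_transform_eventually)
    then show ?thesis
      using 2 by (simp add: kl_term_def)
  next
    case 3
    have "\<forall>\<^sub>F k in F. ereal r < kl_term a (f k)" for r
    proof -
      \<comment> \<open>\<open>a ln (a / b)\<close> exceeds \<open>r\<close> exactly for \<open>0 < b < a exp (- r / a)\<close>.\<close>
      have "\<forall>\<^sub>F k in F. f k < a * exp (- r / a)"
        using lim 3 by (intro order_tendstoD(2)[OF lim]) simp
      then show ?thesis
      proof eventually_elim
        case (elim k)
        show ?case
        proof (cases "f k = 0")
          case False
          then have pos: "0 < f k" using nonneg(2)[of k] by simp
          have "ln (f k) < ln (a * exp (- r / a))"
            using elim pos 3 by simp
          then have "ln (f k) < ln a - r / a"
            using 3 by (simp add: ln_mult)
          then show ?thesis
            using 3 pos by (simp add: kl_term_def ln_div field_simps)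
        qed (use 3 in \<open>simp add: kl_term_def\<close>)
      qed
    qed
    then show ?thesis
      using 3 by (simp add: tendsto_PInfty kl_term_def)
  qed
qed

lemma sum_ereal_not_MInfty:
  fixes f :: "'i \<Rightarrow> ereal"
  assumes "\<And>i. i \<in> I \<Longrightarrow> f i \<noteq> -\<infinity>"
  shows "(\<Sum>i\<in>I. f i) \<noteq> -\<infinity>"
  using assms by (induction I rule: infinite_finite_induct) auto

lemma tendsto_sum_ereal_not_MInfty:
  fixes f :: "'k \<Rightarrow> 'i \<Rightarrow> ereal"
  assumes "\<And>i. i \<in> I \<Longrightarrow> ((\<lambda>k. f k i) \<longlongrightarrow> l i) F" "\<And>i. i \<in> I \<Longrightarrow> l i \<noteq> -\<infinity>"
  shows "((\<lambda>k. \<Sum>i\<in>I. f k i) \<longlongrightarrow> (\<Sum>i\<in>I. l i)) F"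
  using assms
proof (induction I rule: infinite_finite_induct)
  case (insert i I)
  then have "(\<Sum>i\<in>I. l i) \<noteq> -\<infinity>"
    by (intro sum_ereal_not_MInfty) auto
  then show ?case
    using insert by (auto intro!: tendsto_add_ereal_general)
qed auto

lemma kl_term_not_MInfty: "kl_term a b \<noteq> -\<infinity>"
  by (simp add: kl_term_def)

lemma tendsto_KL:
  assumes lim: "\<And>x y. x \<in> Y \<Longrightarrow> y \<in> Y \<Longrightarrow> ((\<lambda>k. L k x y) \<longlongrightarrow> L' x y) F"
    and nonneg: "\<And>x y. 0 \<le> M x y" "\<And>k x y. 0 \<le> L k x y" "\<And>x y. 0 \<le> L' x y"
  shows "((\<lambda>k. KL Y \<pi> M (L k)) \<longlongrightarrow> KL Y \<pi> M L') F"
proof -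
  have row: "(\<Sum>y\<in>Y. kl_term (M x y) (L' x y)) \<noteq> -\<infinity>" for x
    by (intro sum_ereal_not_MInfty kl_term_not_MInfty)
  show ?thesis
    unfolding KL_def
  proof (rule tendsto_sum_ereal_not_MInfty)
    fix x assume x: "x \<in> Y"
    show "((\<lambda>k. ereal (pmf \<pi> x) * (\<Sum>y\<in>Y. kl_term (M x y) (L k x y))) \<longlongrightarrow>
        ereal (pmf \<pi> x) * (\<Sum>y\<in>Y. kl_term (M x y) (L' x y))) F"
      using x by (intro tendsto_cmult_ereal tendsto_sum_ereal_not_MInfty tendsto_kl_term lim nonneg)
        (auto simp: kl_term_not_MInfty)
    show "ereal (pmf \<pi> x) * (\<Sum>y\<in>Y. kl_term (M x y) (L' x y)) \<noteq> -\<infinity>"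
      using row[of x] pmf_nonneg[of \<pi> x]
      by (cases "\<Sum>y\<in>Y. kl_term (M x y) (L' x y)") (auto simp: not_less)
  qed
qed

section \<open>Keep-in matrices and their tensor products\<close>

locale partitioned_space =
  fixes d m :: nat and E :: "nat \<Rightarrow> 'a set" and X :: "'a state set" and \<pi> :: "'a state pmf"
    and S :: "nat \<Rightarrow> nat set"
  assumes finite_E: "\<forall>i\<in>{1..d}. finite (E i)"
    and X_eq: "X = PiE {1..d} E"
    and full_support: "set_pmf \<pi> = X"
    and partition: "partition_on {1..d} (S ` {1..m})"
    and inj_S: "inj_on S {1..m}"
begin

definition proj :: "nat \<Rightarrow> 'a state set" where
  "proj j = (\<lambda>v. restrict v (S j)) ` X"

abbreviation T :: "'a state matrix \<Rightarrow> 'a state matrix" where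
  "T M \<equiv> keep_in_tensor X \<pi> S m M"

lemma finite_X: "finite X"
  using finite_E unfolding X_eq by (intro finite_PiE) auto

lemma finite_proj: "finite (proj j)"
  using finite_X by (simp add: proj_def)

lemma pmf_pos: "x \<in> X \<Longrightarrow> 0 < pmf \<pi> x"
  using full_support by (simp add: pmf_positive_iff)

text \<open>
  Distributivity over the blocks: because the blocks partition the coordinates, a state is the same
  thing as a choice of one projected state per block, and a sum of products over the former becomes
  a product of sums over the latter.
\<close>
lemma sum_prod_restrict:
  fixes f :: "nat \<Rightarrow> 'a state \<Rightarrow> real"
  shows "(\<Sum>v\<in>X. \<Prod>j\<in>{1..m}. f j (restrict v (S j))) = (\<Prod>j\<in>{1..m}. \<Sum>b\<in>proj j. f j b)"
proof -
  have "\<exists>j\<in>{1..m}. i \<in> S j" if "i \<in> {1..d}" for i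
    using partition that by (auto simp: partition_on_def)
  then obtain block where block: "\<And>i. i \<in> {1..d} \<Longrightarrow> block i \<in> {1..m} \<and> i \<in> S (block i)"
    by metis
  have block_unique: "block i = j" if "j \<in> {1..m}" "i \<in> S j" for i j
  proof (rule ccontr)
    assume ne: "block i \<noteq> j"
    have i: "i \<in> {1..d}"
      using partition that by (auto simp: partition_on_def)
    then have "S (block i) \<noteq> S j"
      using ne inj_S that block[OF i] by (auto dest: inj_onD)
    then have "S (block i) \<inter> S j = {}"
      using partition that block[OF i] by (auto simp: partition_on_def disjoint_def)
    then show False
      using block[OF i] that by blast
  qed
  have S_subset: "S j \<subseteq> {1..d}" if "j \<in> {1..m}" for j
    using partition that by (auto simp: partition_on_def)
  define split where "split v = (\<lambda>j\<in>{1..m}. restrict v (S j))" for v :: "'a state"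
  define glue where "glue p = (\<lambda>i\<in>{1..d}. p (block i) i)" for p :: "nat \<Rightarrow> 'a state"
  have restrict_glue: "restrict (glue p) (S j) = p j"
    if p: "p \<in> PiE {1..m} proj" and j: "j \<in> {1..m}" for p j
  proof -
    obtain u where "p j = restrict u (S j)"
      using PiE_mem[OF p j] by (auto simp: proj_def)
    then show ?thesis
      using block_unique[OF j] S_subset[OF j] by (auto simp: glue_def fun_eq_iff)
  qed
  have glue_in: "glue p \<in> X" if p: "p \<in> PiE {1..m} proj" for p
    unfolding X_eq glue_def
  proof (rule restrict_PiE_iff[THEN iffD2], rule ballI)
    fix i assume i: "i \<in> {1..d}"
    obtain u where "u \<in> X" "p (block i) = restrict u (S (block i))"
      using PiE_mem[OF p, of "block i"] block[OF i] by (auto simp: proj_def)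
    then show "p (block i) i \<in> E i"
      using block[OF i] i by (auto simp: X_eq)
  qed
  have "(\<Sum>v\<in>X. \<Prod>j\<in>{1..m}. f j (restrict v (S j))) =
      (\<Sum>p\<in>PiE {1..m} proj. \<Prod>j\<in>{1..m}. f j (p j))"
  proof (rule sum.reindex_bij_witness[where i = glue and j = split])
    show "glue (split v) = v" if "v \<in> X" for v
      using that block by (auto simp: X_eq glue_def split_def fun_eq_iff PiE_def extensional_def)
    show "split v \<in> PiE {1..m} proj" if "v \<in> X" for v
      using that by (auto simp: split_def proj_def)
    show "split (glue p) = p" if "p \<in> PiE {1..m} proj" for p
      using that restrict_glue[OF that] by (auto simp: split_def fun_eq_iff PiE_def extensional_def)
    show "glue p \<in> X" if "p \<in> PiE {1..m} proj" for p
      using that by (rule glue_in)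
  qed (simp_all add: split_def)
  also have "\<dots> = (\<Prod>j\<in>{1..m}. \<Sum>b\<in>proj j. f j b)"
    by (rule prod_sum_PiE[symmetric]) (simp_all add: finite_proj)
  finally show ?thesis .
qed

text \<open>
  The unnormalized keep-in matrix: the \<open>\<pi>\<close>-mass that one step of \<open>M\<close> moves from the fibre of \<open>a\<close>
  to the fibre of \<open>b\<close>.
\<close>
definition flow :: "nat \<Rightarrow> 'a state matrix \<Rightarrow> 'a state \<Rightarrow> 'a state \<Rightarrow> real" where
  "flow j M a b = (\<Sum>u\<in>{u\<in>X. restrict u (S j) = a}. \<Sum>v\<in>{v\<in>X. restrict v (S j) = b}. pmf \<pi> u * M u v)"

definition mass :: "nat \<Rightarrow> 'a state \<Rightarrow> real" where
  "mass j a = (\<Sum>u\<in>{u\<in>X. restrict u (S j) = a}. pmf \<pi> u)"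

lemma keep_in_eq: "keep_in X \<pi> (S j) M a b = flow j M a b / mass j a"
  by (simp add: keep_in_def flow_def mass_def)

lemma mass_pos: "a \<in> proj j \<Longrightarrow> 0 < mass j a"
  unfolding mass_def proj_def using finite_X
  by (intro sum_pos) (auto simp: pmf_pos)

text \<open>
  The expectation, over one step of \<open>M\<close> started in \<open>\<pi>\<close>, of a function of the \<open>j\<close>-th blocks of
  both endpoints depends on \<open>M\<close> only through its flow on that block.
\<close>
lemma sum_flow:
  "(\<Sum>a\<in>proj j. \<Sum>b\<in>proj j. flow j M a b * f a b) =
    (\<Sum>x\<in>X. \<Sum>y\<in>X. pmf \<pi> x * M x y * f (restrict x (S j)) (restrict y (S j)))"
proof -
  let ?r = "\<lambda>v. restrict v (S j)"
  have "(\<Sum>x\<in>X. \<Sum>y\<in>X. pmf \<pi> x * M x y * f (?r x) (?r y)) =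
      (\<Sum>a\<in>proj j. \<Sum>x\<in>{x\<in>X. ?r x = a}. \<Sum>y\<in>X. pmf \<pi> x * M x y * f (?r x) (?r y))"
    by (rule sum.group[symmetric]) (auto simp: finite_X finite_proj proj_def)
  also have "\<dots> = (\<Sum>a\<in>proj j. \<Sum>x\<in>{x\<in>X. ?r x = a}. \<Sum>b\<in>proj j. \<Sum>y\<in>{y\<in>X. ?r y = b}.
      pmf \<pi> x * M x y * f (?r x) (?r y))"
    by (intro sum.cong refl sum.group[symmetric]) (auto simp: finite_X finite_proj proj_def)
  also have "\<dots> = (\<Sum>a\<in>proj j. \<Sum>b\<in>proj j. \<Sum>x\<in>{x\<in>X. ?r x = a}. \<Sum>y\<in>{y\<in>X. ?r y = b}.
      pmf \<pi> x * M x y * f (?r x) (?r y))"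
    by (intro sum.cong refl sum.swap)
  also have "\<dots> = (\<Sum>a\<in>proj j. \<Sum>b\<in>proj j. flow j M a b * f a b)"
    unfolding flow_def sum_distrib_right by (intro sum.cong refl) auto
  finally show ?thesis ..
qed

lemma keep_in_row_sum:
  assumes "M \<in> transition_matrices X" "a \<in> proj j"
  shows "(\<Sum>b\<in>proj j. keep_in X \<pi> (S j) M a b) = 1"
proof -
  have "(\<Sum>b\<in>proj j. flow j M a b) =
      (\<Sum>u\<in>{u\<in>X. restrict u (S j) = a}. \<Sum>b\<in>proj j. \<Sum>v\<in>{v\<in>X. restrict v (S j) = b}. pmf \<pi> u * M u v)"
    unfolding flow_def by (rule sum.swap)
  also have "\<dots> = (\<Sum>u\<in>{u\<in>X. restrict u (S j) = a}. \<Sum>v\<in>X. pmf \<pi> u * M u v)"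
    by (intro sum.cong refl sum.group) (auto simp: finite_X finite_proj proj_def)
  also have "\<dots> = mass j a"
    using assms(1) by (simp add: mass_def transition_matrices_def flip: sum_distrib_left)
  finally show ?thesis
    using mass_pos[OF assms(2)] by (simp add: keep_in_eq flip: sum_divide_distrib)
qed

lemma keep_in_nonneg:
  assumes "\<forall>x y. 0 \<le> M x y"
  shows "0 \<le> keep_in X \<pi> S' M a b"
  using assms by (auto simp: keep_in_def intro!: divide_nonneg_nonneg sum_nonneg)

lemma keep_in_nonzeroE:
  assumes "keep_in X \<pi> S' M a b \<noteq> 0"
  obtains u v where "u \<in> X" "v \<in> X" "restrict u S' = a" "restrict v S' = b" "M u v \<noteq> 0"
proof -
  have "(\<Sum>u\<in>{u\<in>X. restrict u S' = a}. \<Sum>v\<in>{v\<in>X. restrict v S' = b}. pmf \<pi> u * M u v) \<noteq> 0"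
    using assms by (auto simp: keep_in_def)
  then obtain u where u: "u \<in> {u\<in>X. restrict u S' = a}"
      "(\<Sum>v\<in>{v\<in>X. restrict v S' = b}. pmf \<pi> u * M u v) \<noteq> 0"
    by (rule sum.not_neutral_contains_not_neutral)
  from u(2) obtain v where "v \<in> {v\<in>X. restrict v S' = b}" "pmf \<pi> u * M u v \<noteq> 0"
    by (rule sum.not_neutral_contains_not_neutral)
  with u(1) show ?thesis
    by (intro that[of u v]) auto
qed

lemma keep_in_pos:
  assumes nonneg: "\<forall>x y. 0 \<le> M x y" and xy: "x \<in> X" "y \<in> X" and pos: "M x y \<noteq> 0"
  shows "0 < keep_in X \<pi> S' M (restrict x S') (restrict y S')"
proof -
  let ?U = "{u\<in>X. restrict u S' = restrict x S'}" and ?V = "{v\<in>X. restrict v S' = restrict y S'}"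
  have "0 < pmf \<pi> x * M x y"
    using nonneg pos pmf_pos[OF xy(1)] by (simp add: less_le)
  also have "\<dots> \<le> (\<Sum>v\<in>?V. pmf \<pi> x * M x v)"
    using xy finite_X nonneg by (intro member_le_sum) auto
  also have "\<dots> \<le> (\<Sum>u\<in>?U. \<Sum>v\<in>?V. pmf \<pi> u * M u v)"
    using xy finite_X nonneg
    by (intro member_le_sum[of x ?U "\<lambda>u. \<Sum>v\<in>?V. pmf \<pi> u * M u v"] sum_nonneg) auto
  finally have "0 < (\<Sum>u\<in>?U. \<Sum>v\<in>?V. pmf \<pi> u * M u v)" .
  moreover have "0 < (\<Sum>u\<in>?U. pmf \<pi> u)"
    using xy finite_X by (intro sum_pos) (auto simp: pmf_pos)
  ultimately show ?thesis
    by (simp add: keep_in_def)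
qed

lemma keep_in_tensor_apply:
  "x \<in> X \<Longrightarrow> y \<in> X \<Longrightarrow>
    T M x y = (\<Prod>j\<in>{1..m}. keep_in X \<pi> (S j) M (restrict x (S j)) (restrict y (S j)))"
  by (simp add: keep_in_tensor_def tensor_def)

lemma restrict_in_proj: "x \<in> X \<Longrightarrow> restrict x (S j) \<in> proj j"
  by (simp add: proj_def)

lemma keep_in_tensor_nonneg:
  "\<forall>x y. 0 \<le> M x y \<Longrightarrow> 0 \<le> T M x y"
  by (simp add: keep_in_tensor_def tensor_def prod_nonneg keep_in_nonneg)

lemma keep_in_tensor_transition:
  assumes M: "M \<in> transition_matrices X"
  shows "T M \<in> transition_matrices X"
proof -
  have "(\<Sum>y\<in>X. T M x y) = 1" if x: "x \<in> X" for x
  proof -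
    have "(\<Sum>y\<in>X. T M x y) =
        (\<Sum>y\<in>X. \<Prod>j\<in>{1..m}. keep_in X \<pi> (S j) M (restrict x (S j)) (restrict y (S j)))"
      by (simp add: x keep_in_tensor_apply)
    also have "\<dots> = (\<Prod>j\<in>{1..m}. \<Sum>b\<in>proj j. keep_in X \<pi> (S j) M (restrict x (S j)) b)"
      by (rule sum_prod_restrict)
    also have "\<dots> = 1"
      by (intro prod.neutral ballI keep_in_row_sum[OF M] restrict_in_proj x)
    finally show ?thesis .
  qed
  moreover have "\<forall>x y. 0 \<le> M x y"
    using M by (auto simp: transition_matrices_def)
  then have "0 \<le> T M x y" for x y
    by (rule keep_in_tensor_nonneg)
  ultimately show ?thesis
    by (auto simp: transition_matrices_def keep_in_tensor_def tensor_def)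
qed

text \<open>
  Taking the product of the keep-in matrices does not change any of them. Summing the product over
  all targets in a fibre of block \<open>k\<close> turns the factors of the other blocks into row sums, which are
  one, and leaves the \<open>k\<close>-th factor.
\<close>
lemma flow_keep_in_tensor:
  assumes M: "M \<in> transition_matrices X" and k: "k \<in> {1..m}"
  shows "flow k (T M) a b = flow k M a b"
proof (cases "a \<in> proj k \<and> b \<in> proj k")
  case False
  then have "{u\<in>X. restrict u (S k) = a} = {} \<or> {v\<in>X. restrict v (S k) = b} = {}"
    by (auto simp: proj_def)
  then show ?thesis
    unfolding flow_def by (elim disjE) (simp_all only: sum.empty sum.neutral_const)
next
  case True
  let ?K = "\<lambda>j. keep_in X \<pi> (S j) M"
  have row: "(\<Sum>v\<in>{v\<in>X. restrict v (S k) = b}. T M u v) = ?K k a b"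
    if u: "u \<in> X" "restrict u (S k) = a" for u
  proof -
    \<comment> \<open>The constraint on the \<open>k\<close>-th block is absorbed into the \<open>k\<close>-th factor, so that the sum
      runs over all states and distributes.\<close>
    define f where "f j c = ?K j (restrict u (S j)) c * (if j = k \<and> c \<noteq> b then 0 else 1)" for j c
    have "(\<Sum>v\<in>{v\<in>X. restrict v (S k) = b}. T M u v) =
        (\<Sum>v\<in>X. T M u v * (if restrict v (S k) = b then 1 else 0))"
      using finite_X by (simp add: sum.inter_filter if_distrib cong: if_cong)
    also have "\<dots> = (\<Sum>v\<in>X. \<Prod>j\<in>{1..m}. f j (restrict v (S j)))"
    proof (intro sum.cong refl)
      fix v assume v: "v \<in> X"
      have "(\<Prod>j\<in>{1..m}. if j = k \<and> restrict v (S j) \<noteq> b then 0 else 1 :: real) =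
          (\<Prod>j\<in>{1..m}. if j = k then (if restrict v (S k) = b then 1 else 0) else 1)"
        by (intro prod.cong) auto
      also have "\<dots> = (if restrict v (S k) = b then 1 else 0)"
        using k by (simp add: prod.delta)
      finally show "T M u v * (if restrict v (S k) = b then 1 else 0) =
          (\<Prod>j\<in>{1..m}. f j (restrict v (S j)))"
        by (simp add: f_def prod.distrib keep_in_tensor_apply u v)
    qed
    also have "\<dots> = (\<Prod>j\<in>{1..m}. \<Sum>c\<in>proj j. f j c)"
      by (rule sum_prod_restrict)
    also have "\<dots> = (\<Prod>j\<in>{1..m}. if j = k then ?K k a b else 1)"
    proof (intro prod.cong refl)
      fix j assume "j \<in> {1..m}"
      show "(\<Sum>c\<in>proj j. f j c) = (if j = k then ?K k a b else 1)"
      proof (cases "j = k")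
        case True
        then have "(\<Sum>c\<in>proj j. f j c) = (\<Sum>c\<in>proj k. if c = b then ?K k a b else 0)"
          by (intro sum.cong) (auto simp: f_def u)
        then show ?thesis
          using True \<open>a \<in> proj k \<and> b \<in> proj k\<close> by (simp add: finite_proj)
      next
        case False
        then show ?thesis
          using keep_in_row_sum[OF M restrict_in_proj[OF u(1)]] by (simp add: f_def)
      qed
    qed
    also have "\<dots> = ?K k a b"
      using k by (simp add: prod.delta)
    finally show ?thesis .
  qed
  have "flow k (T M) a b = (\<Sum>u\<in>{u\<in>X. restrict u (S k) = a}. pmf \<pi> u * ?K k a b)"
    unfolding flow_def by (intro sum.cong refl) (auto simp: row simp flip: sum_distrib_left)
  also have "\<dots> = mass k a * ?K k a b"
    by (simp add: mass_def sum_distrib_right)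
  also have "\<dots> = flow k M a b"
    using mass_pos[of a k] True by (simp add: keep_in_eq)
  finally show ?thesis .
qed

lemma keep_in_tensor_factorizable:
  assumes M: "M \<in> transition_matrices X"
  shows "T M \<in> factorizable X \<pi> S m"
proof -
  have "T (T M) = T M"
    unfolding keep_in_tensor_def[of X \<pi> S m "T M"]
    by (subst (2) keep_in_tensor_def)
      (auto simp: tensor_def keep_in_eq flow_keep_in_tensor[OF M] intro!: ext prod.cong)
  then show ?thesis
    using keep_in_tensor_transition[OF M] by (simp add: factorizable_def)
qed

end

section \<open>The compensation identity\<close>

text \<open>
  The payoff with weights in place of Nature's measure (\<open>payoff_weight_measure\<close>): a finite sum,
  linear in \<open>w\<close>, with \<open>0 * \<infinity> = 0\<close> for matrices that Nature does not play.
\<close>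
definition mixed_risk ::
    "'a state set \<Rightarrow> 'a state pmf \<Rightarrow> nat \<Rightarrow> (nat \<Rightarrow> 'a state matrix) \<Rightarrow> (nat \<Rightarrow> real) \<Rightarrow>
     'a state matrix \<Rightarrow> ereal" where
  "mixed_risk X \<pi> n P w Q = (\<Sum>i\<in>{1..n}. ereal (w i) * KL X \<pi> (P i) Q)"

lemma weight_objective_eq_mixed_risk:
  "weight_objective X \<pi> S m n P w =
    mixed_risk X \<pi> n P w (keep_in_tensor X \<pi> S m (mixture n P w))"
  by (simp add: weight_objective_def mixed_risk_def)

lemma weight_simplexD:
  assumes "w \<in> weight_simplex n"
  shows "\<And>i. i \<in> {1..n} \<Longrightarrow> 0 \<le> w i" "(\<Sum>i\<in>{1..n}. w i) = 1"
  using assms by (auto simp: weight_simplex_def PiE_def Pi_def)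

lemma mixture_transition:
  assumes w: "w \<in> weight_simplex n" and P: "\<And>i. i \<in> {1..n} \<Longrightarrow> P i \<in> transition_matrices Y"
  shows "mixture n P w \<in> transition_matrices Y"
proof -
  have "(\<Sum>y\<in>Y. mixture n P w x y) = 1" if "x \<in> Y" for x
  proof -
    have "(\<Sum>y\<in>Y. mixture n P w x y) = (\<Sum>i\<in>{1..n}. w i * (\<Sum>y\<in>Y. P i x y))"
      unfolding mixture_def sum_distrib_left by (rule sum.swap)
    also have "\<dots> = 1"
      using P that weight_simplexD(2)[OF w] by (simp add: transition_matrices_def)
    finally show ?thesis .
  qed
  moreover have "0 \<le> mixture n P w x y" for x y
    using P weight_simplexD(1)[OF w]
    by (auto simp: mixture_def transition_matrices_def intro!: sum_nonneg)
  moreover have "mixture n P w x y = 0" if "x \<notin> Y \<or> y \<notin> Y" for x y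
    using P that by (auto simp: mixture_def transition_matrices_def intro!: sum.neutral)
  ultimately show ?thesis
    by (auto simp: transition_matrices_def)
qed

lemma dominated_mixture:
  assumes nonneg: "\<And>i. i \<in> {1..n} \<Longrightarrow> 0 \<le> w i" "\<And>i x y. i \<in> {1..n} \<Longrightarrow> 0 \<le> P i x y"
    and i: "i \<in> {1..n}" "0 < w i"
  shows "dominated Y (P i) (mixture n P w)"
  unfolding dominated_def
proof (intro ballI impI)
  fix x y assume "mixture n P w x y = 0"
  then have "w i * P i x y = 0"
    using nonneg i(1) unfolding mixture_def by (subst (asm) sum_nonneg_eq_0_iff) auto
  then show "P i x y = 0"
    using i(2) by simp
qed

lemma dominated_trans: "dominated Y M N \<Longrightarrow> dominated Y N L \<Longrightarrow> dominated Y M L"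
  by (auto simp: dominated_def)

lemma mixture_dominated:
  assumes "\<And>i. i \<in> {1..n} \<Longrightarrow> w i \<noteq> 0 \<Longrightarrow> dominated Y (P i) L"
  shows "dominated Y (mixture n P w) L"
  using assms by (fastforce simp: dominated_def mixture_def intro!: sum.neutral)

context partitioned_space
begin

lemma dominated_keep_in_tensor:
  assumes "\<forall>x y. 0 \<le> M x y"
  shows "dominated X M (T M)"
proof -
  have "T M x y \<noteq> 0" if "x \<in> X" "y \<in> X" "M x y \<noteq> 0" for x y
    using keep_in_pos[OF assms that] that by (simp add: keep_in_tensor_apply less_imp_neq[symmetric])
  then show ?thesis
    by (auto simp: dominated_def)
qed

text \<open>
  A transition that has positive probability under the product for \<open>M\<close> is possible block by block
  under \<open>M\<close>, hence under \<open>Q\<close>; as \<open>Q\<close> is itself a product, the transition is possible under \<open>Q\<close>.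
\<close>
lemma keep_in_tensor_dominated:
  assumes dom: "dominated X M Q" and Q: "Q \<in> factorizable X \<pi> S m"
  shows "dominated X (T M) Q"
  unfolding dominated_def
proof (intro ballI impI, rule ccontr)
  fix x y assume xy: "x \<in> X" "y \<in> X" "Q x y = 0" and pos: "T M x y \<noteq> 0"
  have Q_eq: "Q = T Q" and Q_nonneg: "\<forall>x y. 0 \<le> Q x y"
    using Q by (auto simp: factorizable_def transition_matrices_def)
  have "keep_in X \<pi> (S j) Q (restrict x (S j)) (restrict y (S j)) \<noteq> 0" if j: "j \<in> {1..m}" for j
  proof -
    have "keep_in X \<pi> (S j) M (restrict x (S j)) (restrict y (S j)) \<noteq> 0"
      using pos xy j by (auto simp: keep_in_tensor_apply)
    then obtain u v where uv: "u \<in> X" "v \<in> X" "restrict u (S j) = restrict x (S j)"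
        "restrict v (S j) = restrict y (S j)" "M u v \<noteq> 0"
      by (rule keep_in_nonzeroE)
    then have "Q u v \<noteq> 0"
      using dom by (auto simp: dominated_def)
    then show ?thesis
      using keep_in_pos[OF Q_nonneg uv(1,2), where S'="S j"] uv by simp
  qed
  then have "T Q x y \<noteq> 0"
    using xy by (simp add: keep_in_tensor_apply)
  then show False
    using xy Q_eq by simp
qed

text \<open>
  The logarithm of a ratio of two product matrices is a sum of functions of single blocks, so its
  expectation sees only the flows on the blocks, and these are the same for \<open>M\<close> and for its product
  approximation.
\<close>
lemma sum_ln_ratio_keep_in_tensor:
  assumes M: "M \<in> transition_matrices X" and dom: "dominated X M Q"
    and Q: "Q \<in> factorizable X \<pi> S m"
  shows "(\<Sum>x\<in>X. \<Sum>y\<in>X. pmf \<pi> x * M x y * ln (T M x y / Q x y)) =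
    (\<Sum>x\<in>X. \<Sum>y\<in>X. pmf \<pi> x * T M x y * ln (T M x y / Q x y))"
proof -
  let ?K = "\<lambda>N j x y. keep_in X \<pi> (S j) N (restrict x (S j)) (restrict y (S j))"
  define \<phi> where "\<phi> j a b = ln (keep_in X \<pi> (S j) M a b / keep_in X \<pi> (S j) Q a b)" for j a b
  have M_nonneg: "\<forall>x y. 0 \<le> M x y" and Q_nonneg: "\<forall>x y. 0 \<le> Q x y" and Q_eq: "Q = T Q"
    using M Q by (auto simp: factorizable_def transition_matrices_def)
  have split: "ln (T M x y / Q x y) = (\<Sum>j\<in>{1..m}. \<phi> j (restrict x (S j)) (restrict y (S j)))"
    if xy: "x \<in> X" "y \<in> X" "T M x y \<noteq> 0" for x y
  proof -
    have TQ: "T Q x y \<noteq> 0"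
      using keep_in_tensor_dominated[OF dom Q] xy Q_eq by (auto simp: dominated_def)
    have pos: "0 < ?K M j x y" "0 < ?K Q j x y" if "j \<in> {1..m}" for j
      using xy TQ that keep_in_nonneg[OF M_nonneg] keep_in_nonneg[OF Q_nonneg]
      by (auto simp: keep_in_tensor_apply less_le)
    have "T M x y / Q x y = T M x y / T Q x y"
      using Q_eq by simp
    also have "\<dots> = (\<Prod>j\<in>{1..m}. ?K M j x y / ?K Q j x y)"
      using xy by (simp add: keep_in_tensor_apply prod_dividef)
    finally have "ln (T M x y / Q x y) = ln (\<Prod>j\<in>{1..m}. ?K M j x y / ?K Q j x y)"
      by (rule arg_cong)
    also have "\<dots> = (\<Sum>j\<in>{1..m}. ln (?K M j x y / ?K Q j x y))"
    proof (rule ln_prod)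
      fix j assume "j \<in> {1..m}"
      then show "?K M j x y / ?K Q j x y \<noteq> 0"
        using pos[of j] by simp
    qed simp
    finally show ?thesis
      unfolding \<phi>_def .
  qed
  \<comment> \<open>The splitting may fail where the product matrix vanishes (there \<open>ln 0 = 0\<close>), so it is used only
    under matrices that vanish there too.\<close>
  have expand: "(\<Sum>x\<in>X. \<Sum>y\<in>X. pmf \<pi> x * N x y * ln (T M x y / Q x y)) =
      (\<Sum>j\<in>{1..m}. \<Sum>a\<in>proj j. \<Sum>b\<in>proj j. flow j N a b * \<phi> j a b)"
    if N: "dominated X N (T M)" for N
  proof -
    have "(\<Sum>x\<in>X. \<Sum>y\<in>X. pmf \<pi> x * N x y * ln (T M x y / Q x y)) =
        (\<Sum>x\<in>X. \<Sum>y\<in>X. \<Sum>j\<in>{1..m}.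
          pmf \<pi> x * N x y * \<phi> j (restrict x (S j)) (restrict y (S j)))"
    proof (intro sum.cong refl)
      fix x y assume xy: "x \<in> X" "y \<in> X"
      show "pmf \<pi> x * N x y * ln (T M x y / Q x y) =
          (\<Sum>j\<in>{1..m}. pmf \<pi> x * N x y * \<phi> j (restrict x (S j)) (restrict y (S j)))"
      proof (cases "N x y = 0")
        case False
        then have "T M x y \<noteq> 0"
          using N xy by (auto simp: dominated_def)
        then show ?thesis
          by (simp only: split[OF xy \<open>T M x y \<noteq> 0\<close>] sum_distrib_left)
      qed simp
    qed
    also have "\<dots> = (\<Sum>x\<in>X. \<Sum>j\<in>{1..m}. \<Sum>y\<in>X.
          pmf \<pi> x * N x y * \<phi> j (restrict x (S j)) (restrict y (S j)))"
      by (intro sum.cong refl sum.swap)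
    also have "\<dots> = (\<Sum>j\<in>{1..m}. \<Sum>x\<in>X. \<Sum>y\<in>X.
          pmf \<pi> x * N x y * \<phi> j (restrict x (S j)) (restrict y (S j)))"
      by (rule sum.swap)
    finally show ?thesis
      by (simp add: sum_flow)
  qed
  show ?thesis
    using flow_keep_in_tensor[OF M] dominated_keep_in_tensor[OF M_nonneg]
    by (simp add: expand dominated_def)
qed

text \<open>
  The compensation identity (Pythagorean identity for mixtures). The difference of the two risks is
  the expectation of \<open>ln (T / Q)\<close> under the mixture, where \<open>T\<close> is the product approximation of the
  mixture; by \<open>sum_ln_ratio_keep_in_tensor\<close> it is also the expectation under \<open>T\<close>, which is a
  divergence. If some matrix of positive weight is not dominated by \<open>Q\<close>, then neither is \<open>T\<close>,
  and both sides are infinite.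
\<close>
lemma mixed_risk_compensation:
  assumes w: "w \<in> weight_simplex n" and P: "\<And>i. i \<in> {1..n} \<Longrightarrow> P i \<in> transition_matrices X"
    and Q: "Q \<in> factorizable X \<pi> S m"
  shows "mixed_risk X \<pi> n P w Q =
    mixed_risk X \<pi> n P w (T (mixture n P w)) + KL X \<pi> (T (mixture n P w)) Q"
proof -
  let ?M = "mixture n P w"
  let ?I = "{i\<in>{1..n}. 0 < w i}"
  have M: "?M \<in> transition_matrices X"
    using w P by (rule mixture_transition)
  have M_nonneg: "\<forall>x y. 0 \<le> ?M x y" and P_nonneg: "\<And>i x y. i \<in> {1..n} \<Longrightarrow> 0 \<le> P i x y"
    using M P by (auto simp: transition_matrices_def)
  note w_nonneg = weight_simplexD(1)[OF w]
  have P_M: "dominated X (P i) ?M" if "i \<in> ?I" for i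
    using that w_nonneg P_nonneg by (intro dominated_mixture) auto
  have P_TM: "dominated X (P i) (T ?M)" if "i \<in> ?I" for i
    using P_M[OF that] dominated_keep_in_tensor[OF M_nonneg] by (rule dominated_trans)
  have support: "mixed_risk X \<pi> n P w L = (\<Sum>i\<in>?I. ereal (w i) * KL X \<pi> (P i) L)" for L
    unfolding mixed_risk_def using w_nonneg
    by (intro sum.mono_neutral_right) (auto simp: less_le simp flip: zero_ereal_def)
  have real: "mixed_risk X \<pi> n P w L =
      ereal (\<Sum>i\<in>?I. \<Sum>x\<in>X. \<Sum>y\<in>X. w i * (pmf \<pi> x * P i x y * ln (P i x y / L x y)))"
    if "\<And>i. i \<in> ?I \<Longrightarrow> dominated X (P i) L" for L
    unfolding support using that by (simp add: KL_dominated sum_distrib_left)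
  show ?thesis
  proof (cases "\<forall>i\<in>?I. dominated X (P i) Q")
    case True
    have M_Q: "dominated X ?M Q"
      using True w_nonneg by (intro mixture_dominated) (auto simp: less_le)
    have TM_Q: "dominated X (T ?M) Q"
      using M_Q Q by (rule keep_in_tensor_dominated)
    let ?lr = "\<lambda>x y. ln (T ?M x y / Q x y)"
    have step: "w i * (pmf \<pi> x * P i x y * ln (P i x y / Q x y)) =
        w i * (pmf \<pi> x * P i x y * ln (P i x y / T ?M x y)) +
        pmf \<pi> x * (w i * P i x y) * ln (T ?M x y / Q x y)"
      if "i \<in> ?I" "x \<in> X" "y \<in> X" for i x y
    proof (cases "P i x y = 0")
      case False
      then have "P i x y > 0" "T ?M x y > 0" "Q x y > 0"
        using that True P_TM[of i] P_nonneg[of i x y] keep_in_tensor_nonneg[OF M_nonneg, where x = x and y = y] Q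
        by (auto simp: dominated_def less_le factorizable_def transition_matrices_def)
      then show ?thesis
        by (simp add: ln_div algebra_simps)
    qed simp
    have "(\<Sum>i\<in>?I. \<Sum>x\<in>X. \<Sum>y\<in>X. pmf \<pi> x * (w i * P i x y) * ln (T ?M x y / Q x y)) =
        (\<Sum>x\<in>X. \<Sum>y\<in>X. \<Sum>i\<in>?I. pmf \<pi> x * (w i * P i x y) * ln (T ?M x y / Q x y))"
      by (subst sum.swap, intro sum.cong refl) (rule sum.swap)
    also have "\<dots> = (\<Sum>x\<in>X. \<Sum>y\<in>X. pmf \<pi> x * ?M x y * ln (T ?M x y / Q x y))"
    proof (intro sum.cong refl)
      fix x y
      have "(\<Sum>i\<in>?I. w i * P i x y) = ?M x y"
        unfolding mixture_def using w_nonneg by (intro sum.mono_neutral_left) (auto simp: less_le)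
      then show "(\<Sum>i\<in>?I. pmf \<pi> x * (w i * P i x y) * ln (T ?M x y / Q x y)) =
          pmf \<pi> x * ?M x y * ln (T ?M x y / Q x y)"
        by (simp only: flip: sum_distrib_left sum_distrib_right)
    qed
    also have "\<dots> = (\<Sum>x\<in>X. \<Sum>y\<in>X. pmf \<pi> x * T ?M x y * ln (T ?M x y / Q x y))"
      using M M_Q Q by (rule sum_ln_ratio_keep_in_tensor)
    finally have drift: "(\<Sum>i\<in>?I. \<Sum>x\<in>X. \<Sum>y\<in>X. pmf \<pi> x * (w i * P i x y) * ?lr x y) =
        (\<Sum>x\<in>X. \<Sum>y\<in>X. pmf \<pi> x * T ?M x y * ?lr x y)" .
    have "mixed_risk X \<pi> n P w Q =
        ereal (\<Sum>i\<in>?I. \<Sum>x\<in>X. \<Sum>y\<in>X. w i * (pmf \<pi> x * P i x y * ln (P i x y / Q x y)))"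
      using True by (intro real) blast
    also have "(\<Sum>i\<in>?I. \<Sum>x\<in>X. \<Sum>y\<in>X. w i * (pmf \<pi> x * P i x y * ln (P i x y / Q x y))) =
        (\<Sum>i\<in>?I. \<Sum>x\<in>X. \<Sum>y\<in>X. w i * (pmf \<pi> x * P i x y * ln (P i x y / T ?M x y)) +
          pmf \<pi> x * (w i * P i x y) * ?lr x y)"
      by (intro sum.cong refl step)
    also have "\<dots> = (\<Sum>i\<in>?I. \<Sum>x\<in>X. \<Sum>y\<in>X. w i * (pmf \<pi> x * P i x y * ln (P i x y / T ?M x y))) +
        (\<Sum>x\<in>X. \<Sum>y\<in>X. pmf \<pi> x * T ?M x y * ?lr x y)"
      by (simp only: sum.distrib drift)
    also have "ereal \<dots> = mixed_risk X \<pi> n P w (T ?M) + KL X \<pi> (T ?M) Q"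
      by (simp only: real[OF P_TM] KL_dominated[OF TM_Q] plus_ereal.simps)
    finally show ?thesis .
  next
    case False
    then obtain i where i: "i \<in> ?I" "\<not> dominated X (P i) Q"
      by blast
    have "KL X \<pi> (P i) Q = \<infinity>"
      using i(2) finite_X full_support by (intro KL_not_dominated) auto
    then have "ereal (w i) * KL X \<pi> (P i) Q = \<infinity>"
      using i(1) by simp
    then have "mixed_risk X \<pi> n P w Q = \<infinity>"
      unfolding support using i(1) by (auto simp: sum_Pinfty)
    moreover have "\<not> dominated X (T ?M) Q"
      using i P_TM dominated_trans by blast
    then have "KL X \<pi> (T ?M) Q = \<infinity>"
      using finite_X full_support by (intro KL_not_dominated) auto
    ultimately show ?thesis
      by (simp add: real P_TM)
  qed
qed

end

section \<open>Nature's mixed strategies\<close>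

lemma weight_measure_prob:
  assumes w: "w \<in> weight_simplex n"
  shows "weight_measure n P w \<in> prob_measures (P ` {1..n})"
proof -
  have "(\<Sum>i\<in>{1..n}. ennreal (w i)) = 1"
    using weight_simplexD[OF w] by (subst sum_ennreal) auto
  then have "prob_space (point_measure {1..n} (\<lambda>i. ennreal (w i)))"
    by (intro prob_spaceI) (simp add: space_point_measure emeasure_point_measure_finite)
  then have "prob_space (weight_measure n P w)"
    unfolding weight_measure_def by (rule prob_space.prob_space_distr) simp
  then show ?thesis
    by (simp add: prob_measures_def weight_measure_def)
qed

lemma emeasure_weight_measure:
  assumes w: "w \<in> weight_simplex n" and b: "b \<in> P ` {1..n}"
  shows "emeasure (weight_measure n P w) {b} = ennreal (\<Sum>i\<in>{i\<in>{1..n}. P i = b}. w i)"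
proof -
  have "emeasure (weight_measure n P w) {b} =
      emeasure (point_measure {1..n} (\<lambda>i. ennreal (w i))) (P -` {b} \<inter> {1..n})"
    unfolding weight_measure_def using b
    by (subst emeasure_distr) (auto simp: space_point_measure)
  also have "\<dots> = (\<Sum>i\<in>{i\<in>{1..n}. P i = b}. ennreal (w i))"
    by (subst emeasure_point_measure_finite) (auto intro!: sum.cong)
  finally show ?thesis
    using weight_simplexD(1)[OF w] by (subst (asm) sum_ennreal) auto
qed

text \<open>
  When the family has repetitions, a measure does not determine the weights; the mass of a point is
  split evenly among the indices that name it.
\<close>
lemma prob_measures_eq_weight_measures:
  "prob_measures (P ` {1..n}) = weight_measure n P ` weight_simplex n"
proof (rule set_eqI, rule iffI)
  fix \<mu> assume \<mu>: "\<mu> \<in> prob_measures (P ` {1..n})"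
  interpret prob_space \<mu>
    using \<mu> by (simp add: prob_measures_def)
  have sp: "space \<mu> = P ` {1..n}" "sets \<mu> = Pow (P ` {1..n})"
    using \<mu> by (simp_all add: prob_measures_def)
  define fibre where "fibre b = {i\<in>{1..n}. P i = b}" for b
  define w where "w = (\<lambda>i\<in>{1..n}. measure \<mu> {P i} / card (fibre (P i)))"
  have fibre_sum: "(\<Sum>i\<in>fibre b. w i) = measure \<mu> {b}" if "b \<in> P ` {1..n}" for b
  proof -
    have "card (fibre b) \<noteq> 0"
      using that by (auto simp: fibre_def)
    moreover have "(\<Sum>i\<in>fibre b. w i) = (\<Sum>i\<in>fibre b. measure \<mu> {b} / card (fibre b))"
      by (intro sum.cong) (auto simp: w_def fibre_def)
    ultimately show ?thesis
      by simp
  qed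
  have "(\<Sum>i\<in>{1..n}. w i) = (\<Sum>b\<in>P ` {1..n}. \<Sum>i\<in>fibre b. w i)"
    unfolding fibre_def by (rule sum.group[symmetric]) auto
  also have "\<dots> = (\<Sum>b\<in>P ` {1..n}. measure \<mu> {b})"
    by (intro sum.cong refl fibre_sum)
  also have "\<dots> = measure \<mu> (P ` {1..n})"
    by (rule finite_measure_eq_sum_singleton[symmetric]) (auto simp: sp)
  also have "\<dots> = 1"
    using prob_space by (simp add: sp)
  finally have w: "w \<in> weight_simplex n"
    by (auto simp: weight_simplex_def w_def)
  have "\<mu> = weight_measure n P w"
  proof (rule measure_eqI_finite[where A = "P ` {1..n}"])
    fix b assume b: "b \<in> P ` {1..n}"
    then show "emeasure \<mu> {b} = emeasure (weight_measure n P w) {b}"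
      using fibre_sum[OF b] by (simp add: emeasure_weight_measure[OF w b] fibre_def emeasure_eq_measure)
  qed (auto simp: sp weight_measure_def)
  then show "\<mu> \<in> weight_measure n P ` weight_simplex n"
    using w by blast
qed (use weight_measure_prob in blast)

lemma payoff_weight_measure:
  assumes w: "w \<in> weight_simplex n" and P: "\<And>i. i \<in> {1..n} \<Longrightarrow> P i \<in> transition_matrices X"
    and Q: "Q \<in> transition_matrices X"
  shows "payoff X \<pi> (weight_measure n P w) Q = mixed_risk X \<pi> n P w Q"
proof -
  let ?f = "\<lambda>M. e2ennreal (KL X \<pi> M Q)"
  have "(\<integral>\<^sup>+ M. ?f M \<partial>weight_measure n P w) =
      (\<integral>\<^sup>+ i. ?f (P i) \<partial>point_measure {1..n} (\<lambda>i. ennreal (w i)))"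
    unfolding weight_measure_def by (rule nn_integral_distr) (auto simp: space_point_measure)
  also have "\<dots> = (\<Sum>i\<in>{1..n}. ennreal (w i) * ?f (P i))"
    by (rule nn_integral_point_measure_finite) simp
  finally have "payoff X \<pi> (weight_measure n P w) Q =
      (\<Sum>i\<in>{1..n}. enn2ereal (ennreal (w i) * ?f (P i)))"
    by (simp add: payoff_def)
  also have "\<dots> = mixed_risk X \<pi> n P w Q"
    unfolding mixed_risk_def
    using weight_simplexD(1)[OF w] KL_nonneg[OF P Q]
    by (intro sum.cong refl) (simp add: times_ennreal.rep_eq enn2ereal_e2ennreal)
  finally show ?thesis .
qed

section \<open>The weight simplex\<close>

definition blend :: "nat \<Rightarrow> real \<Rightarrow> (nat \<Rightarrow> real) \<Rightarrow> (nat \<Rightarrow> real) \<Rightarrow> nat \<Rightarrow> real" where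
  "blend n t w v = (\<lambda>i\<in>{1..n}. (1 - t) * w i + t * v i)"

definition vertex :: "nat \<Rightarrow> nat \<Rightarrow> nat \<Rightarrow> real" where
  "vertex n i = (\<lambda>j\<in>{1..n}. if j = i then 1 else 0)"

lemma blend_in_simplex:
  assumes "w \<in> weight_simplex n" "v \<in> weight_simplex n" "0 \<le> t" "t \<le> 1"
  shows "blend n t w v \<in> weight_simplex n"
  using assms weight_simplexD[OF assms(1)] weight_simplexD[OF assms(2)]
  by (auto simp: weight_simplex_def blend_def sum.distrib simp flip: sum_distrib_left)

lemma vertex_in_simplex: "i \<in> {1..n} \<Longrightarrow> vertex n i \<in> weight_simplex n"
  by (auto simp: weight_simplex_def vertex_def)

lemma mixed_risk_vertex: 
  assumes "i \<in> {1..n}"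
  shows "mixed_risk X \<pi> n P (vertex n i) Q = KL X \<pi> (P i) Q"
proof -
  have "mixed_risk X \<pi> n P (vertex n i) Q = (\<Sum>j\<in>{1..n}. if j = i then KL X \<pi> (P j) Q else 0)"
    unfolding mixed_risk_def by (intro sum.cong) (auto simp: vertex_def simp flip: zero_ereal_def one_ereal_def)
  then show ?thesis
    using assms by simp
qed

lemma mixed_risk_blend:
  assumes w: "w \<in> weight_simplex n" and v: "v \<in> weight_simplex n" and t: "0 \<le> t" "t \<le> 1"
    and P: "\<And>i. i \<in> {1..n} \<Longrightarrow> P i \<in> transition_matrices X" and Q: "Q \<in> transition_matrices X"
  shows "mixed_risk X \<pi> n P (blend n t w v) Q =
    ereal (1 - t) * mixed_risk X \<pi> n P w Q + ereal t * mixed_risk X \<pi> n P v Q"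
proof -
  have scale: "ereal c * mixed_risk X \<pi> n P u Q = (\<Sum>i\<in>{1..n}. ereal (c * u i) * KL X \<pi> (P i) Q)"
    if "u \<in> weight_simplex n" for u c
    unfolding mixed_risk_def using weight_simplexD(1)[OF that] KL_nonneg[OF P Q]
    by (subst sum_ereal_right_distrib) (auto simp: mult.assoc[symmetric])
  have "mixed_risk X \<pi> n P (blend n t w v) Q =
      (\<Sum>i\<in>{1..n}. ereal ((1 - t) * w i) * KL X \<pi> (P i) Q + ereal (t * v i) * KL X \<pi> (P i) Q)"
    unfolding mixed_risk_def
  proof (intro sum.cong refl)
    fix i assume i: "i \<in> {1..n}"
    have "0 \<le> (1 - t) * w i" "0 \<le> t * v i"
      using t weight_simplexD(1)[OF w i] weight_simplexD(1)[OF v i] by simp_all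
    then show "ereal (blend n t w v i) * KL X \<pi> (P i) Q =
        ereal ((1 - t) * w i) * KL X \<pi> (P i) Q + ereal (t * v i) * KL X \<pi> (P i) Q"
      using i by (simp add: blend_def flip: ereal_left_distrib plus_ereal.simps)
  qed
  then show ?thesis
    by (simp add: sum.distrib scale w v)
qed

text \<open>
  Tychonoff's theorem gives compactness; outside \<open>{1..n}\<close> the weights are constantly \<open>undefined\<close>,
  so these coordinates range over a singleton.
\<close>
lemma weight_simplex_convergent_subseq:
  assumes f: "\<And>k. f k \<in> weight_simplex n"
  obtains w r where "w \<in> weight_simplex n" "strict_mono (r :: nat \<Rightarrow> nat)"
    "\<forall>i\<in>{1..n}. (\<lambda>k. f (r k) i) \<longlonglongrightarrow> w i"
proof -
  define K where "K = PiE UNIV (\<lambda>i. if i \<in> {1..n} then {0..1} else {undefined :: real})"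
  have "compactin (product_topology (\<lambda>i. euclidean) UNIV) K"
    unfolding K_def compactin_PiE by auto
  then have "compact K"
    by (simp add: euclidean_product_topology)
  then have "seq_compact K"
    by (rule compact_imp_seq_compact)
  moreover have "f k \<in> K" for k
  proof -
    have "f k i \<le> 1" if "i \<in> {1..n}" for i
      using member_le_sum[of i "{1..n}" "f k"] that weight_simplexD[OF f[of k]] by auto
    then show ?thesis
      using weight_simplexD(1)[OF f[of k]] f[of k]
      by (auto simp: K_def weight_simplex_def PiE_def extensional_def)
  qed
  ultimately obtain w r where w: "w \<in> K" and r: "strict_mono (r :: nat \<Rightarrow> nat)"
      and lim: "(f \<circ> r) \<longlonglongrightarrow> w"
    unfolding seq_compact_def by blast
  have lim_i: "(\<lambda>k. f (r k) i) \<longlonglongrightarrow> w i" for i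
    using continuous_on_tendsto_compose[OF continuous_on_product_coordinates lim] by simp
  have "(\<lambda>k. \<Sum>i\<in>{1..n}. f (r k) i) \<longlonglongrightarrow> (\<Sum>i\<in>{1..n}. w i)"
    by (intro tendsto_sum lim_i)
  then have "(\<lambda>k. 1) \<longlonglongrightarrow> (\<Sum>i\<in>{1..n}. w i)"
    using weight_simplexD(2)[OF f] by simp
  then have "(\<Sum>i\<in>{1..n}. w i) = 1"
    by (simp add: LIMSEQ_const_iff)
  moreover have "w i \<ge> 0" if "i \<in> {1..n}" for i
    using w that by (auto simp: K_def PiE_def Pi_def dest: spec[of _ i])
  moreover have "w i = undefined" if "i \<notin> {1..n}" for i
    using w that by (auto simp: K_def PiE_def Pi_def dest: spec[of _ i])
  ultimately have "w \<in> weight_simplex n"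
    by (auto simp: weight_simplex_def PiE_def extensional_def)
  then show ?thesis
    using r lim_i by (intro that) auto
qed

section \<open>The information projection\<close>

context partitioned_space
begin

lemma factorizable_transition: "Q \<in> factorizable X \<pi> S m \<Longrightarrow> Q \<in> transition_matrices X"
  by (simp add: factorizable_def)

lemma KL_keep_in_tensor_finite:
  assumes "M \<in> transition_matrices X"
  shows "KL X \<pi> M (T M) \<noteq> \<infinity>"
  using dominated_keep_in_tensor[of M] assms finite_X full_support
  by (simp add: KL_finite_iff transition_matrices_def)

text \<open>
  The compensation identity for a family with a single member.
\<close>
lemma KL_pythagoras:
  assumes M: "M \<in> transition_matrices X" and Q: "Q \<in> factorizable X \<pi> S m"
  shows "KL X \<pi> M Q = KL X \<pi> M (T M) + KL X \<pi> (T M) Q"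
proof -
  have mix: "mixture 1 (\<lambda>_. M) (vertex 1 1) = M"
    by (simp add: mixture_def vertex_def)
  have "KL X \<pi> M L = mixed_risk X \<pi> 1 (\<lambda>_. M) (vertex 1 1) L" for L
    by (simp add: mixed_risk_vertex)
  then show ?thesis
    using mixed_risk_compensation[of "vertex 1 1" 1 "\<lambda>_. M", OF _ M Q]
    unfolding mix by (simp only: vertex_in_simplex atLeastAtMost_singleton singletonI)
qed

text \<open>
  In \<open>KL_pythagoras\<close> the first summand is finite and does not depend on \<open>Q\<close>, and the second is nonnegative
  and zero only at the product approximation.
\<close>
lemma information_projection_iff:
  assumes M: "M \<in> transition_matrices X"
  shows "information_projection X \<pi> S m M Q \<longleftrightarrow> Q = T M"
proof
  note TM = keep_in_tensor_factorizable[OF M]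
  note trans = factorizable_transition
  {
    assume "Q = T M"
    moreover have "KL X \<pi> M (T M) \<le> KL X \<pi> M L" if "L \<in> factorizable X \<pi> S m" for L
      using KL_pythagoras[OF M that] KL_nonneg[OF trans[OF TM] trans[OF that]]
      by (simp add: ereal_le_add_self)
    ultimately show "information_projection X \<pi> S m M Q"
      using TM by (auto simp: information_projection_def is_arg_min_def not_less)
  next
    assume "information_projection X \<pi> S m M Q"
    then have Q: "Q \<in> factorizable X \<pi> S m" and le: "KL X \<pi> M Q \<le> KL X \<pi> M (T M)"
      using TM by (auto simp: information_projection_def is_arg_min_def not_less)
    have "KL X \<pi> (T M) Q \<le> 0"
      using le KL_pythagoras[OF M Q] KL_keep_in_tensor_finite[OF M]
        KL_nonneg[OF M trans[OF TM]] KL_nonneg[OF trans[OF TM] trans[OF Q]]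
      by (cases "KL X \<pi> M (T M)"; cases "KL X \<pi> (T M) Q") (auto simp flip: zero_ereal_def)
    then show "Q = T M"
      using KL_eq_0_imp_eq[OF finite_X _ trans[OF TM] trans[OF Q]] full_support by auto
  }
qed

end

section \<open>Optimal weights\<close>

locale mixed_strategy_game = partitioned_space d m E X \<pi> S
  for d m :: nat and E :: "nat \<Rightarrow> 'a set" and X :: "'a state set" and \<pi> :: "'a state pmf"
    and S :: "nat \<Rightarrow> nat set" +
  fixes n :: nat and P :: "nat \<Rightarrow> 'a state matrix"
  assumes n_pos: "1 \<le> n"
    and P_transition: "i \<in> {1..n} \<Longrightarrow> P i \<in> transition_matrices X"
begin

abbreviation risk :: "(nat \<Rightarrow> real) \<Rightarrow> 'a state matrix \<Rightarrow> ereal" where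
  "risk \<equiv> mixed_risk X \<pi> n P"

abbreviation response :: "(nat \<Rightarrow> real) \<Rightarrow> 'a state matrix" where
  "response w \<equiv> T (mixture n P w)"

abbreviation objective :: "(nat \<Rightarrow> real) \<Rightarrow> ereal" where
  "objective \<equiv> weight_objective X \<pi> S m n P"

lemma objective_eq: "objective w = risk w (response w)"
  by (rule weight_objective_eq_mixed_risk)

lemma P_nonneg: "i \<in> {1..n} \<Longrightarrow> 0 \<le> P i x y"
  using P_transition by (auto simp: transition_matrices_def)

lemma mixture_in_transition: "w \<in> weight_simplex n \<Longrightarrow> mixture n P w \<in> transition_matrices X"
  by (intro mixture_transition P_transition)

lemma response_factorizable: "w \<in> weight_simplex n \<Longrightarrow> response w \<in> factorizable X \<pi> S m"
  by (simp add: keep_in_tensor_factorizable mixture_in_transition)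

lemma response_transition: "w \<in> weight_simplex n \<Longrightarrow> response w \<in> transition_matrices X"
  by (simp add: keep_in_tensor_transition mixture_in_transition)

text \<open>
  Thus the objective is the minimum of the risk over product matrices, attained at the response.
\<close>
lemma objective_le_risk:
  assumes w: "w \<in> weight_simplex n" and Q: "Q \<in> factorizable X \<pi> S m"
  shows "objective w \<le> risk w Q"
  using mixed_risk_compensation[OF w P_transition Q]
    KL_nonneg[OF response_transition[OF w], of Q \<pi>] Q
  by (simp add: objective_eq ereal_le_add_self factorizable_def)

lemma risk_nonneg:
  assumes "w \<in> weight_simplex n" "Q \<in> transition_matrices X"
  shows "0 \<le> risk w Q"
  unfolding mixed_risk_def using weight_simplexD(1)[OF assms(1)] KL_nonneg[OF P_transition assms(2)]
  by (intro sum_nonneg) auto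

lemma KL_response_finite:
  assumes w: "w \<in> weight_simplex n" and i: "i \<in> {1..n}" "0 < w i"
  shows "KL X \<pi> (P i) (response w) \<noteq> \<infinity>"
proof -
  have "dominated X (P i) (mixture n P w)"
    using weight_simplexD(1)[OF w] P_nonneg i by (intro dominated_mixture) auto
  moreover have "dominated X (mixture n P w) (response w)"
    using mixture_in_transition[OF w]
    by (intro dominated_keep_in_tensor) (simp add: transition_matrices_def)
  ultimately show ?thesis
    using dominated_trans finite_X full_support by (subst KL_finite_iff) auto
qed

lemma objective_finite:
  assumes w: "w \<in> weight_simplex n"
  shows "\<bar>objective w\<bar> \<noteq> \<infinity>"
proof -
  have "ereal (w i) * KL X \<pi> (P i) (response w) \<noteq> \<infinity>" if i: "i \<in> {1..n}" for i
    using KL_response_finite[OF w i] weight_simplexD(1)[OF w i]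
      KL_nonneg[OF P_transition[OF i] response_transition[OF w], of \<pi>]
    by (cases "KL X \<pi> (P i) (response w)"; cases "w i = 0") (auto simp flip: zero_ereal_def)
  then have "objective w \<noteq> \<infinity>"
    by (auto simp: objective_eq mixed_risk_def sum_Pinfty)
  then show ?thesis
    using risk_nonneg[OF w response_transition[OF w]] by (auto simp: objective_eq)
qed

lemma tendsto_KL_response:
  assumes v: "\<And>k. v k \<in> weight_simplex n" and w: "w \<in> weight_simplex n"
    and lim: "\<And>i. i \<in> {1..n} \<Longrightarrow> ((\<lambda>k. v k i) \<longlongrightarrow> w i) F"
    and i: "i \<in> {1..n}"
  shows "((\<lambda>k. KL X \<pi> (P i) (response (v k))) \<longlongrightarrow> KL X \<pi> (P i) (response w)) F"
proof (rule tendsto_KL)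
  have mix: "((\<lambda>k. mixture n P (v k) x y) \<longlongrightarrow> mixture n P w x y) F" for x y
    unfolding mixture_def by (intro tendsto_sum tendsto_mult lim tendsto_const)
  show "((\<lambda>k. response (v k) x y) \<longlongrightarrow> response w x y) F" if "x \<in> X" "y \<in> X" for x y
    unfolding keep_in_tensor_apply[OF that] keep_in_def divide_inverse
    by (intro tendsto_prod tendsto_mult tendsto_sum tendsto_const mix)
  show "0 \<le> P i x y" for x y
    using i by (rule P_nonneg)
  show "0 \<le> response (v k) x y" for k x y
    using response_transition[OF v] by (auto simp: transition_matrices_def)
  show "0 \<le> response w x y" for x y
    using response_transition[OF w] by (auto simp: transition_matrices_def)
qed

lemma tendsto_risk_response:
  assumes u: "u \<in> weight_simplex n" and v: "\<And>k. v k \<in> weight_simplex n" and w: "w \<in> weight_simplex n"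
    and lim: "\<And>i. i \<in> {1..n} \<Longrightarrow> ((\<lambda>k. v k i) \<longlongrightarrow> w i) F"
  shows "((\<lambda>k. risk u (response (v k))) \<longlongrightarrow> risk u (response w)) F"
  unfolding mixed_risk_def
proof (rule tendsto_sum_ereal_not_MInfty)
  fix i assume i: "i \<in> {1..n}"
  show "((\<lambda>k. ereal (u i) * KL X \<pi> (P i) (response (v k))) \<longlongrightarrow>
      ereal (u i) * KL X \<pi> (P i) (response w)) F"
    by (intro tendsto_cmult_ereal tendsto_KL_response v w lim i) simp
  have "0 \<le> ereal (u i) * KL X \<pi> (P i) (response w)"
    using weight_simplexD(1)[OF u i] KL_nonneg[OF P_transition[OF i] response_transition[OF w]]
    by simp
  then show "ereal (u i) * KL X \<pi> (P i) (response w) \<noteq> -\<infinity>"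
    by auto
qed

lemma tendsto_blend:
  assumes "i \<in> {1..n}"
  shows "(\<lambda>k. blend n (1 / real (Suc k)) w v i) \<longlonglongrightarrow> w i"
proof -
  have "(\<lambda>k. (1 - 1 / real (Suc k)) * w i + 1 / real (Suc k) * v i) \<longlonglongrightarrow> (1 - 0) * w i + 0 * v i"
    by (intro tendsto_intros LIMSEQ_Suc[OF lim_1_over_n])
  then show ?thesis
    using assms by (simp add: blend_def)
qed

text \<open>
  The variational inequality for an optimal \<open>w\<close>, which is the saddle point condition. Move from \<open>w\<close>
  towards \<open>u\<close> by \<open>t\<close> and let \<open>Q\<^sub>t\<close> be the response there. Optimality gives
  \<open>objective w \<ge> (1 - t) risk w Q\<^sub>t + t risk u Q\<^sub>t \<ge> (1 - t) objective w + t risk u Q\<^sub>t\<close>,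
  that is \<open>risk u Q\<^sub>t \<le> objective w\<close> for \<open>0 < t \<le> 1\<close>, and \<open>t\<close> tends to zero; continuity of
  \<open>KL\<close> in the extended reals makes the bound pass to the limit even where the limit was not
  known to be finite.
\<close>
lemma risk_response_optimal:
  assumes opt: "optimal_weight X \<pi> S m n P w" and u: "u \<in> weight_simplex n"
  shows "risk u (response w) \<le> objective w"
proof -
  have w: "w \<in> weight_simplex n"
    and max: "\<And>v. v \<in> weight_simplex n \<Longrightarrow> objective v \<le> objective w"
    using opt by (auto simp: optimal_weight_def is_arg_max_def not_less)
  let ?v = "\<lambda>k. blend n (1 / real (Suc k)) w u"
  have v: "?v k \<in> weight_simplex n" for k
    using w u by (intro blend_in_simplex) auto
  have le: "risk u (response (?v k)) \<le> objective w" for k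
  proof -
    let ?t = "1 / real (Suc k)" and ?Q = "response (?v k)"
    have t: "0 < ?t" "?t \<le> 1"
      by auto
    obtain a where a: "objective w = ereal a"
      using objective_finite[OF w] by auto
    have "ereal (1 - ?t) * objective w + ereal ?t * risk u ?Q \<le>
        ereal (1 - ?t) * risk w ?Q + ereal ?t * risk u ?Q"
      using t by (intro add_right_mono ereal_mult_left_mono objective_le_risk w response_factorizable v) auto
    also have "\<dots> = objective (?v k)"
      unfolding objective_eq
      using w u t by (intro mixed_risk_blend[symmetric] P_transition response_transition v) auto
    also have "\<dots> \<le> objective w"
      by (intro max v)
    finally have *: "ereal (1 - ?t) * ereal a + ereal ?t * risk u ?Q \<le> ereal a"
      by (simp only: a)
    show ?thesis
    proof (cases "risk u ?Q")
      case (real r)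
      then have "(1 - ?t) * a + ?t * r \<le> a"
        using * by simp
      then have "?t * r \<le> ?t * a"
        by (simp add: algebra_simps)
      then show ?thesis
        using t real a by (simp only: mult_le_cancel_left_pos ereal_less_eq)
    next
      case PInf
      then show ?thesis
        using * t by simp
    qed simp
  qed
  have "(\<lambda>k. risk u (response (?v k))) \<longlonglongrightarrow> risk u (response w)"
    by (intro tendsto_risk_response u v w tendsto_blend)
  then show ?thesis
    by (rule LIMSEQ_le_const2) (use le in blast)
qed

text \<open>
  Along a maximizing sequence that converges to some \<open>w\<close>, the objective is bounded by the risk
  against any fixed product matrix. Blending \<open>w\<close> with the uniform weights makes every divergence
  from the corresponding response finite, so that this bound passes to the limit \<open>w\<close>; then the share
  of the uniform weights is sent to zero.
\<close>
lemma ex_optimal_weight: "\<exists>w. optimal_weight X \<pi> S m n P w"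
proof -
  define unif where "unif = (\<lambda>i\<in>{1..n}. 1 / real n)"
  have unif: "unif \<in> weight_simplex n"
    using n_pos by (auto simp: unif_def weight_simplex_def)
  let ?V = "objective ` weight_simplex n"
  obtain g where g: "incseq g" "range g \<subseteq> ?V" "Sup ?V = (SUP k. g k)"
    using Sup_countable_SUP[of ?V] unif by blast
  have "\<exists>v. v \<in> weight_simplex n \<and> g k = objective v" for k
    using g(2) by blast
  then obtain f where f: "\<And>k. f k \<in> weight_simplex n" "\<And>k. g k = objective (f k)"
    by metis
  obtain w r where w: "w \<in> weight_simplex n" and r: "strict_mono (r :: nat \<Rightarrow> nat)"
    and f_w: "\<forall>i\<in>{1..n}. (\<lambda>k. f (r k) i) \<longlonglongrightarrow> w i"
    using weight_simplex_convergent_subseq[of f n] f(1) by blast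
  have "g \<longlonglongrightarrow> Sup ?V"
    unfolding g(3) using g(1) by (rule LIMSEQ_SUP)
  from LIMSEQ_subseq_LIMSEQ[OF this r]
  have g_lim: "(\<lambda>k. objective (f (r k))) \<longlonglongrightarrow> Sup ?V"
    by (simp add: f(2) comp_def)
  have bound: "Sup ?V \<le> risk w (response (blend n t w unif))" if t: "0 < t" "t \<le> 1" for t
  proof -
    let ?b = "blend n t w unif"
    have b: "?b \<in> weight_simplex n"
      using w unif t by (intro blend_in_simplex) auto
    have fin: "\<bar>KL X \<pi> (P i) (response ?b)\<bar> \<noteq> \<infinity>" if i: "i \<in> {1..n}" for i
    proof -
      have "0 < t * unif i" "0 \<le> (1 - t) * w i"
        using t i weight_simplexD(1)[OF w i] by (simp_all add: unif_def)
      then have "0 < ?b i"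
        using i by (simp add: blend_def)
      then show ?thesis
        using KL_response_finite[OF b i] KL_nonneg[OF P_transition[OF i] response_transition[OF b], of \<pi>]
        by auto
    qed
    have "(\<lambda>k. risk (f (r k)) (response ?b)) \<longlonglongrightarrow> risk w (response ?b)"
      unfolding mixed_risk_def
    proof (rule tendsto_sum_ereal_not_MInfty)
      fix i assume i: "i \<in> {1..n}"
      show "(\<lambda>k. ereal (f (r k) i) * KL X \<pi> (P i) (response ?b)) \<longlonglongrightarrow>
          ereal (w i) * KL X \<pi> (P i) (response ?b)"
        by (intro tendsto_mult_ereal tendsto_ereal f_w[rule_format] i tendsto_const) (use fin[OF i] in auto)
      show "ereal (w i) * KL X \<pi> (P i) (response ?b) \<noteq> -\<infinity>"
        using fin[OF i] by auto
    qed
    with g_lim show ?thesis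
      by (rule LIMSEQ_le) (use objective_le_risk[OF f(1) response_factorizable[OF b]] in blast)
  qed
  let ?v = "\<lambda>k. blend n (1 / real (Suc k)) w unif"
  have "(\<lambda>k. risk w (response (?v k))) \<longlonglongrightarrow> risk w (response w)"
    using w unif by (intro tendsto_risk_response tendsto_blend blend_in_simplex) auto
  then have "Sup ?V \<le> risk w (response w)"
    by (rule LIMSEQ_le_const) (use bound in auto)
  then have "objective v \<le> objective w" if "v \<in> weight_simplex n" for v
    using that by (auto simp: objective_eq Sup_le_iff)
  then have "optimal_weight X \<pi> S m n P w"
    using w by (auto simp: optimal_weight_def is_arg_max_def not_less)
  then show ?thesis
    by blast
qed

section \<open>Equilibrium and value\<close>

text \<open>
  The risk is linear in the weights, so it is maximal at a vertex. This yields a best response of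
  Nature to any \<open>Q\<close>, also when the risk is infinite.
\<close>
lemma ex_worst_vertex:
  assumes Q: "Q \<in> transition_matrices X"
  obtains i where "i \<in> {1..n}" "\<And>w. w \<in> weight_simplex n \<Longrightarrow> risk w Q \<le> risk (vertex n i) Q"
proof -
  let ?K = "\<lambda>i. KL X \<pi> (P i) Q"
  have "Max (?K ` {1..n}) \<in> ?K ` {1..n}"
    using n_pos by (intro Max_in) auto
  then obtain i where i: "i \<in> {1..n}" "Max (?K ` {1..n}) = ?K i"
    by blast
  have worst: "?K j \<le> ?K i" if "j \<in> {1..n}" for j
    unfolding i(2)[symmetric] using that by (intro Max_ge) auto
  have "risk w Q \<le> risk (vertex n i) Q" if w: "w \<in> weight_simplex n" for w
  proof -
    have "risk w Q \<le> (\<Sum>j\<in>{1..n}. ereal (w j) * ?K i)"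
      unfolding mixed_risk_def
      using weight_simplexD(1)[OF w] worst by (intro sum_mono ereal_mult_left_mono) auto
    also have "\<dots> = (\<Sum>j\<in>{1..n}. ereal (w j)) * ?K i"
      using weight_simplexD(1)[OF w] by (intro sum_ereal_left_distrib[symmetric]) auto
    also have "(\<Sum>j\<in>{1..n}. ereal (w j)) = 1"
      using weight_simplexD(2)[OF w] by (simp add: sum_ereal one_ereal_def)
    finally show ?thesis
      by (simp add: mixed_risk_vertex[OF i(1)])
  qed
  with i(1) show ?thesis
    by (rule that)
qed

lemma payoff_eq_risk:
  "w \<in> weight_simplex n \<Longrightarrow> Q \<in> factorizable X \<pi> S m \<Longrightarrow>
    payoff X \<pi> (weight_measure n P w) Q = risk w Q"
  by (intro payoff_weight_measure P_transition) (simp_all add: factorizable_def)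

lemma best_payoff_eq_objective:
  assumes w: "w \<in> weight_simplex n"
  shows "best_payoff X \<pi> S m (weight_measure n P w) = objective w"
proof (rule antisym)
  show "best_payoff X \<pi> S m (weight_measure n P w) \<le> objective w"
    unfolding best_payoff_def objective_eq
    using payoff_eq_risk[OF w response_factorizable[OF w]]
    by (intro INF_lower2[OF response_factorizable[OF w]]) simp
  show "objective w \<le> best_payoff X \<pi> S m (weight_measure n P w)"
    unfolding best_payoff_def
    by (intro INF_greatest) (simp add: payoff_eq_risk w objective_le_risk)
qed

lemma nash_equilibrium_optimal:
  assumes opt: "optimal_weight X \<pi> S m n P w"
  shows "nash_equilibrium X \<pi> S m (P ` {1..n}) (response w) (weight_measure n P w)"
proof -
  have w: "w \<in> weight_simplex n"
    using opt by (simp add: optimal_weight_def is_arg_max_def)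
  note Q = response_factorizable[OF w]
  have value_eq: "payoff X \<pi> (weight_measure n P w) (response w) = objective w"
    using payoff_eq_risk[OF w Q] by (simp add: objective_eq)
  show ?thesis
    unfolding nash_equilibrium_def value_eq prob_measures_eq_weight_measures
    using Q w risk_response_optimal[OF opt] objective_le_risk[OF w]
    by (auto simp: payoff_eq_risk)
qed

lemma lower_value_eq: "lower_value X \<pi> S m (P ` {1..n}) = (SUP w\<in>weight_simplex n. objective w)"
  unfolding lower_value_def prob_measures_eq_weight_measures image_image
  by (intro SUP_cong refl best_payoff_eq_objective)

lemma lower_value_attained: "lower_value_attained X \<pi> S m (P ` {1..n})"
proof -
  have "is_arg_min (payoff X \<pi> (weight_measure n P w)) (\<lambda>Q. Q \<in> factorizable X \<pi> S m) (response w)"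
    if w: "w \<in> weight_simplex n" for w
    using objective_le_risk[OF w] response_factorizable[OF w]
    by (auto simp: is_arg_min_def payoff_eq_risk[OF w] objective_eq not_less)
  moreover obtain w where w: "optimal_weight X \<pi> S m n P w"
    using ex_optimal_weight by blast
  then have "is_arg_max (best_payoff X \<pi> S m) (\<lambda>\<mu>. \<mu> \<in> prob_measures (P ` {1..n})) (weight_measure n P w)"
    unfolding prob_measures_eq_weight_measures
    by (auto simp: optimal_weight_def is_arg_max_def best_payoff_eq_objective)
  ultimately show ?thesis
    unfolding lower_value_attained_def prob_measures_eq_weight_measures by blast
qed

lemma worst_payoff_response_optimal:
  assumes opt: "optimal_weight X \<pi> S m n P w"
  shows "worst_payoff X \<pi> (P ` {1..n}) (response w) = objective w"
    and "Q \<in> factorizable X \<pi> S m \<Longrightarrow> objective w \<le> worst_payoff X \<pi> (P ` {1..n}) Q"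
proof -
  have w: "w \<in> weight_simplex n"
    using opt by (simp add: optimal_weight_def is_arg_max_def)
  note Q' = response_factorizable[OF w]
  show lower: "objective w \<le> worst_payoff X \<pi> (P ` {1..n}) Q" if Q: "Q \<in> factorizable X \<pi> S m" for Q
    unfolding worst_payoff_def prob_measures_eq_weight_measures image_image
    using w objective_le_risk[OF w Q] by (intro SUP_upper2[OF w]) (simp add: payoff_eq_risk Q)
  have "worst_payoff X \<pi> (P ` {1..n}) (response w) \<le> objective w"
    unfolding worst_payoff_def prob_measures_eq_weight_measures image_image
    by (intro SUP_least) (simp add: payoff_eq_risk Q' risk_response_optimal[OF opt])
  then show "worst_payoff X \<pi> (P ` {1..n}) (response w) = objective w"
    using lower[OF Q'] by (rule antisym)
qed

lemma upper_value_eq_lower_value: 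
  "upper_value X \<pi> S m (P ` {1..n}) = lower_value X \<pi> S m (P ` {1..n})"
proof -
  obtain w where opt: "optimal_weight X \<pi> S m n P w"
    using ex_optimal_weight by blast
  then have w: "w \<in> weight_simplex n" and max: "\<And>v. v \<in> weight_simplex n \<Longrightarrow> objective v \<le> objective w"
    by (auto simp: optimal_weight_def is_arg_max_def not_less)
  have "upper_value X \<pi> S m (P ` {1..n}) = objective w"
    unfolding upper_value_def
  proof (rule INF_eqI)
    show "y \<le> objective w"
      if "\<And>Q. Q \<in> factorizable X \<pi> S m \<Longrightarrow> y \<le> worst_payoff X \<pi> (P ` {1..n}) Q" for y
      using that[OF response_factorizable[OF w]] by (simp only: worst_payoff_response_optimal[OF opt])
  qed (rule worst_payoff_response_optimal[OF opt])
  moreover have "lower_value X \<pi> S m (P ` {1..n}) = objective w"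
    unfolding lower_value_eq using w max by (intro SUP_eqI) auto
  ultimately show ?thesis
    by simp
qed

lemma upper_value_attained: "upper_value_attained X \<pi> S m (P ` {1..n})"
proof -
  have "\<exists>\<mu>. is_arg_max (\<lambda>\<mu>. payoff X \<pi> \<mu> Q) (\<lambda>\<mu>. \<mu> \<in> prob_measures (P ` {1..n})) \<mu>"
    if Q: "Q \<in> factorizable X \<pi> S m" for Q
  proof -
    obtain i where i: "i \<in> {1..n}" "\<And>w. w \<in> weight_simplex n \<Longrightarrow> risk w Q \<le> risk (vertex n i) Q"
      using ex_worst_vertex[of Q] Q by (auto simp: factorizable_def)
    have "is_arg_max (\<lambda>\<mu>. payoff X \<pi> \<mu> Q) (\<lambda>\<mu>. \<mu> \<in> prob_measures (P ` {1..n}))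
        (weight_measure n P (vertex n i))"
      unfolding prob_measures_eq_weight_measures
      using i vertex_in_simplex[OF i(1)] by (auto simp: is_arg_max_def payoff_eq_risk Q not_less)
    then show ?thesis ..
  qed
  moreover obtain w where opt: "optimal_weight X \<pi> S m n P w"
    using ex_optimal_weight by blast
  then have "is_arg_min (worst_payoff X \<pi> (P ` {1..n})) (\<lambda>Q. Q \<in> factorizable X \<pi> S m) (response w)"
    using worst_payoff_response_optimal[OF opt] 
    by (auto simp: is_arg_min_def not_less optimal_weight_def is_arg_max_def intro: response_factorizable)
  ultimately show ?thesis
    unfolding upper_value_attained_def by blast
qed

end

theorem theorem4p1:
  fixes d m n :: nat
    and E :: "nat \<Rightarrow> 'a set"
    and X :: "'a state set"
    and \<pi> :: "'a state pmf"
    and S :: "nat \<Rightarrow> nat set"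
    and P :: "nat \<Rightarrow> 'a state matrix"
    and B :: "'a state matrix set"
  assumes "\<forall>i\<in>{1..d}. finite (E i)"
    and "X = PiE {1..d} E"
    and "set_pmf \<pi> = X"
    and "partition_on {1..d} (S ` {1..m})" and "inj_on S {1..m}"
    and "1 \<le> n"
    and "\<forall>i\<in>{1..n}. P i \<in> transition_matrices X \<and> stationary X \<pi> (P i)"
    and "B = P ` {1..n}"
  shows
    "(\<exists>Q \<mu>. nash_equilibrium X \<pi> S m B Q \<mu>) \<and>
     upper_value_attained X \<pi> S m B \<and>
     lower_value_attained X \<pi> S m B \<and>
     (\<exists>w. optimal_weight X \<pi> S m n P w) \<and>
     upper_value X \<pi> S m B = lower_value X \<pi> S m B \<and>
     lower_value X \<pi> S m B = (SUP w\<in>weight_simplex n. weight_objective X \<pi> S m n P w) \<and>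
     (\<forall>w. optimal_weight X \<pi> S m n P w \<longrightarrow>
        nash_equilibrium X \<pi> S m B
          (keep_in_tensor X \<pi> S m (mixture n P w)) (weight_measure n P w) \<and>
        (\<forall>Q. information_projection X \<pi> S m (mixture n P w) Q \<longleftrightarrow>
             Q = keep_in_tensor X \<pi> S m (mixture n P w)))"
proof -
  interpret mixed_strategy_game d m E X \<pi> S n P
    using assms by unfold_locales auto
  have projection: "information_projection X \<pi> S m (mixture n P w) Q \<longleftrightarrow> Q = response w"
    if "optimal_weight X \<pi> S m n P w" for w Q
    using that by (intro information_projection_iff mixture_in_transition)
      (simp add: optimal_weight_def is_arg_max_def)
  show ?thesis
    unfolding \<open>B = P ` {1..n}\<close>
    using ex_optimal_weight nash_equilibrium_optimal upper_value_attained lower_value_attained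
      upper_value_eq_lower_value lower_value_eq projection
    by blast
qed

end
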